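(* Let $a>1$, $b>1$, $c>0$, $r>0$, $s>0$ be integers with $\gcd(a,b)>1$. Then the equation $(-1)^u r a^x + (-1)^v s b^y = c$ has at most three solutions $(x,y,u,v)$, except for sets of solutions which are members of families containing one of the basic forms $(2,2,4,1,3;0,0,1,1,3,2,4,2)$, $(2,2,3,1,1;0,1,0,2,1,0,2,0)$, $(6,2,8,1,7;0,0,1,1,2,2,3,5)$, or the associate of one of these. Moreover, there are infinitely many sets of solutions in basic form with $\gcd(a,b)>1$ consisting of three pairs (infinitely many cases of three solutions, even counting only basic forms).
   Context: A solution is a quadruple $(x,y,u,v)$ with $x,y$ nonnegative integers and $u,v\in\{0,1\}$ satisfying the equation; since $(x,y)$ determines $(u,v)$, a solution is referred to by the pair $(x,y)$. A set of solutions, written $(a,b,c,r,s;x_1,y_1,\dots,x_N,y_N)$, is the unordered set of $N>2$ distinct pairs $(x_i,y_i)$, each a solution for the given $a,b,c,r,s$. Two sets of solutions $(a,b,c,r,s;x_1,y_1,\dots,x_N,y_N)$ and $(A,B,C,R,S;X_1,Y_1,\dots,X_N,Y_N)$ are in the same family if $a$ and $A$ are both powers of one integer, $b$ and $B$ are both powers of one integer, and there is a positive rational $k$ with $kc=C$ such that for every $i$ there is $j$ with $kra^{x_i}=RA^{X_j}$ and $ksb^{y_i}=SB^{Y_j}$. A set of solutions is in basic form if $\gcd(r,sb)=\gcd(s,ra)=1$, $\min_i x_i=\min_i y_i=0$, and neither $a$ nor $b$ is a perfect power. The associate of $(a,b,c,r,s;x_1,y_1,\dots,x_N,y_N)$ is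 $(b,a,c,s,r;y_1,x_1,\dots,y_N,x_N)$. *)

theory Defs
  imports Complex_Main "HOL-Computational_Algebra.Nth_Powers"
begin

definition solutions :: "int \<Rightarrow> int \<Rightarrow> int \<Rightarrow> int \<Rightarrow> int \<Rightarrow> (nat \<times> nat \<times> nat \<times> nat) set" where
  "solutions a b c r s =
     {(x, y, u, v). u \<in> {0, 1} \<and> v \<in> {0, 1} \<and> (-1) ^ u * r * a ^ x + (-1) ^ v * s * b ^ y = c}"

definition solution_pairs :: "int \<Rightarrow> int \<Rightarrow> int \<Rightarrow> int \<Rightarrow> int \<Rightarrow> (nat \<times> nat) set" where
  "solution_pairs a b c r s = (\<lambda>(x, y, u, v). (x, y)) ` solutions a b c r s"

lemma solution_pair_determines_signs:
  assumes "a > 1" "b > 1" "c > 0" "r > 0" "s > 0"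
    and "(x, y, u, v) \<in> solutions a b c r s" "(x, y, u', v') \<in> solutions a b c r s"
  shows "u = u' \<and> v = v'"
proof -
  have "r * a ^ x > 0" "s * b ^ y > 0" using assms by simp_all
  thus ?thesis using assms by (auto simp: solutions_def)
qed

type_synonym sol_set = "int \<times> int \<times> int \<times> int \<times> int \<times> (nat \<times> nat) set"

text \<open>
  The tuple \<open>(a, b, c, r, s, P)\<close> stands for
  \<open>(a, b, c, r, s; x\<^sub>1, y\<^sub>1, \<dots>, x\<^sub>N, y\<^sub>N)\<close> with \<open>P = {(x\<^sub>1, y\<^sub>1), \<dots>, (x\<^sub>N, y\<^sub>N)}\<close>
  and \<open>N = card P\<close>. The set \<open>P\<close> need not contain all solutions of the equation.
\<close>

fun is_solution_set :: "sol_set \<Rightarrow> bool" where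
  "is_solution_set (a, b, c, r, s, P) \<longleftrightarrow>
     a > 1 \<and> b > 1 \<and> c > 0 \<and> r > 0 \<and> s > 0 \<and>
     finite P \<and> card P > 2 \<and> P \<subseteq> solution_pairs a b c r s"

definition powers_of_one_integer :: "int \<Rightarrow> int \<Rightarrow> bool" where
  "powers_of_one_integer m n \<longleftrightarrow> (\<exists>d i j. i > 0 \<and> j > 0 \<and> m = d ^ i \<and> n = d ^ j)"

fun same_family :: "sol_set \<Rightarrow> sol_set \<Rightarrow> bool" where
  "same_family (a, b, c, r, s, P) (A, B, C, R, S, Q) \<longleftrightarrow>
     is_solution_set (a, b, c, r, s, P) \<and> is_solution_set (A, B, C, R, S, Q) \<and>
     card P = card Q \<and>
     powers_of_one_integer a A \<and> powers_of_one_integer b B \<and>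
     (\<exists>k::rat. k > 0 \<and> k * of_int c = of_int C \<and>
        (\<forall>(x, y) \<in> P. \<exists>(X, Y) \<in> Q.
           k * of_int r * of_int a ^ x = of_int R * of_int A ^ X \<and>
           k * of_int s * of_int b ^ y = of_int S * of_int B ^ Y))"

definition perfect_power :: "int \<Rightarrow> bool" where
  "perfect_power m \<longleftrightarrow> (\<exists>n\<ge>2. is_nth_power n m)"

fun basic_form :: "sol_set \<Rightarrow> bool" where
  "basic_form (a, b, c, r, s, P) \<longleftrightarrow>
     is_solution_set (a, b, c, r, s, P) \<and>
     gcd r (s * b) = 1 \<and> gcd s (r * a) = 1 \<and>
     Min (fst ` P) = 0 \<and> Min (snd ` P) = 0 \<and>
     \<not> perfect_power a \<and> \<not> perfect_power b"

fun associate :: "sol_set \<Rightarrow> sol_set" where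
  "associate (a, b, c, r, s, P) = (b, a, c, s, r, prod.swap ` P)"

definition exceptional_forms :: "sol_set set" where
  "exceptional_forms =
     {(2, 2, 4, 1, 3, {(0, 0), (1, 1), (3, 2), (4, 2)}),
      (2, 2, 3, 1, 1, {(0, 1), (0, 2), (1, 0), (2, 0)}),
      (6, 2, 8, 1, 7, {(0, 0), (1, 1), (2, 2), (3, 5)})}"

lemma not_perfect_power_if_dvd_once:
  fixes p m :: int
  assumes "prime p" "p dvd m" "\<not> p\<^sup>2 dvd m"
  shows "\<not> perfect_power m"
proof
  assume "perfect_power m"
  then obtain n d where n: "n \<ge> 2" "m = d ^ n"
    by (auto simp: perfect_power_def is_nth_power_def)
  have "p dvd d" using assms n by (auto dest: prime_dvd_power)
  hence "p ^ n dvd m" using n by (simp add: dvd_power_same)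
  moreover have "p\<^sup>2 dvd p ^ n" using n by (simp add: le_imp_power_dvd)
  ultimately show False using assms by (meson dvd_trans)
qed

lemma exceptional_forms_basic_form:
  assumes "F \<in> exceptional_forms"
  shows "basic_form F"
proof -
  have pp: "\<not> perfect_power 2" "\<not> perfect_power 6"
    by (rule not_perfect_power_if_dvd_once[of 2]; simp)+
  have sol: "(x, y) \<in> solution_pairs a b c r s"
    if "(x, y, u, v) \<in> solutions a b c r s" for x y u v a b c r s
    using that by (force simp: solution_pairs_def)
  have 1: "{(0, 0), (1, 1), (3, 2), (4, 2)} \<subseteq> solution_pairs 2 2 4 1 3"
    using sol[of 0 0 0 0] sol[of 1 1 1 0] sol[of 3 2 1 0] sol[of 4 2 0 1]
    by (simp add: solutions_def)
  have 2: "{(0, 1), (0, 2), (1, 0), (2, 0)} \<subseteq> solution_pairs 2 2 3 1 1"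
    using sol[of 0 1 0 0] sol[of 0 2 1 0] sol[of 1 0 0 0] sol[of 2 0 0 1]
    by (simp add: solutions_def)
  have 3: "{(0, 0), (1, 1), (2, 2), (3, 5)} \<subseteq> solution_pairs 6 2 8 1 7"
    using sol[of 0 0 0 0] sol[of 1 1 1 0] sol[of 2 2 0 1] sol[of 3 5 1 0]
    by (simp add: solutions_def)
  show ?thesis
    using assms pp 1 2 3 by (auto simp: exceptional_forms_def gcd_non_0_int)
qed

end

theory Submission
  imports Defs
begin

text \<open>
  Fix a prime \<open>p\<close> dividing both \<open>a\<close> and \<open>b\<close>, let \<open>v\<close> be the \<open>p\<close>-adic valuation, and write
  \<open>X = r a\<^sup>x\<close>, \<open>Y = s b\<^sup>y\<close>. Since \<open>\<plusminus>X \<plusminus> Y = c\<close>, the smallest of \<open>v X\<close>, \<open>v Y\<close>, \<open>v c\<close> is attained twice,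
  so a solution is balanced (\<open>v X = v Y\<close>), left (\<open>v X = v c < v Y\<close>) or right (\<open>v Y = v c < v X\<close>).

  All left solutions share one \<open>x\<close>. If there are two of them, with \<open>Y' < Y\<close>, then \<open>Y = c + X\<close> and
  \<open>Y' = \<bar>c - X\<bar>\<close>; this forces \<open>p = 2\<close> and expresses \<open>c\<close> and \<open>X\<close> through \<open>Y'\<close>. In particular there are
  at most two left and, symmetrically, at most two right solutions.
  Balanced solutions lie on a line, so there \<open>X\<close> and \<open>Y\<close> run through geometric progressions with
  ratios \<open>A\<close>, \<open>B\<close>, both divisible by \<open>p\<close>; if \<open>A > B\<close> then \<open>A \<ge> B + 2\<close>. Three balanced solutions lead to
  \<open>A\<^sup>n (A\<^sup>d - B\<^sup>d) (B\<^sup>n - 1) = (A\<^sup>n + B\<^sup>n) (B\<^sup>d + 1)\<close>, whose only solutions are \<open>n = d = 1\<close>, \<open>A = 6\<close>,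
  \<open>B \<in> {2, 3}\<close>; so there are never four.

  It remains to combine the types. Size comparisons exclude two balanced solutions with a left and a
  right one, and two left solutions with a right and a balanced one. Two balanced and two left
  solutions, two left and two right ones, and three balanced ones with a fourth solution each
  determine all data up to scaling and give the three exceptional families.
\<close>

section \<open>Three solutions in geometric progression\<close>

text \<open>Telescoping: raising \<open>d\<close> adds \<open>B ^ d * (B - 1)\<close> to
  \<open>B ^ d - 1\<close>, while \<open>A ^ d - B ^ d\<close> gains at least
  \<open>(A - B) * B ^ d\<close> with \<open>A - B\<close> at least 2.\<close>

lemma power_diff_ge:
  fixes A B :: int
  assumes "2 \<le> B" "B + 2 \<le> A"
  shows "2 * (B ^ d - 1) \<le> (A ^ d - B ^ d) * (B - 1)"
proof (induction d)
  case (Suc d)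
  have "2 * (B ^ Suc d - 1) = 2 * (B ^ d - 1) + 2 * (B ^ d * (B - 1))"
    by (simp add: algebra_simps)
  also have "\<dots> \<le> A * (2 * (B ^ d - 1)) + (A - B) * (B ^ d * (B - 1))"
  proof (rule add_mono)
    have "0 \<le> 2 * (B ^ d - 1)" using assms by simp
    thus "2 * (B ^ d - 1) \<le> A * (2 * (B ^ d - 1))"
      using assms mult_right_mono[of 1 A "2 * (B ^ d - 1)"] by simp
    show "2 * (B ^ d * (B - 1)) \<le> (A - B) * (B ^ d * (B - 1))"
      by (rule mult_right_mono) (use assms in auto)
  qed
  also have "\<dots> \<le> A * ((A ^ d - B ^ d) * (B - 1)) + (A - B) * (B ^ d * (B - 1))"
    using Suc assms by (intro add_right_mono mult_left_mono) auto
  also have "\<dots> = (A ^ Suc d - B ^ Suc d) * (B - 1)"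
    by (simp add: algebra_simps)
  finally show ?case .
qed simp

text \<open>With \<open>+ 1\<close> on the left the bound fails for \<open>d = 1\<close> (take
  \<open>A = 4\<close>, \<open>B = 2\<close>), so the same induction starts at
  \<open>d = 2\<close>.\<close>

lemma power_diff_ge_of_ge_2:
  fixes A B :: int
  assumes "2 \<le> B" "B + 2 \<le> A" "2 \<le> d"
  shows "2 * (B ^ d + 1) \<le> (A ^ d - B ^ d) * (B - 1)"
  using assms(3)
proof (induction d rule: dec_induct)
  case base
  have "2 * (B\<^sup>2 + 1) \<le> ((B + 2)\<^sup>2 - B\<^sup>2) * (B - 1)"
    using assms(1) mult_mono[of 2 B 2 B] by (simp add: algebra_simps power2_eq_square)
  also have "\<dots> \<le> (A\<^sup>2 - B\<^sup>2) * (B - 1)"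
    using assms by (intro mult_right_mono diff_right_mono power_mono) auto
  finally show ?case .
next
  case (step d)
  have "2 * (B ^ Suc d + 1) = 2 * (B ^ d + 1) + 2 * (B ^ d * (B - 1))"
    by (simp add: algebra_simps)
  also have "\<dots> \<le> A * (2 * (B ^ d + 1)) + (A - B) * (B ^ d * (B - 1))"
  proof (rule add_mono)
    have "0 \<le> 2 * (B ^ d + 1)" using assms by simp
    thus "2 * (B ^ d + 1) \<le> A * (2 * (B ^ d + 1))"
      using assms mult_right_mono[of 1 A "2 * (B ^ d + 1)"] by simp
    show "2 * (B ^ d * (B - 1)) \<le> (A - B) * (B ^ d * (B - 1))"
      by (rule mult_right_mono) (use assms in auto)
  qed
  also have "\<dots> \<le> A * ((A ^ d - B ^ d) * (B - 1)) + (A - B) * (B ^ d * (B - 1))"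
    using step.IH assms by (intro add_right_mono mult_left_mono) auto
  also have "\<dots> = (A ^ Suc d - B ^ Suc d) * (B - 1)"
    by (simp add: algebra_simps)
  finally show ?case .
qed

text \<open>Excludes a last solution of the form \<open>Y = c + X\<close> in
  \<open>three_solutions_on_line\<close>. Since \<open>A ^ n + B ^ n < 2 * A ^ n\<close>, it reduces
  to \<open>power_diff_ge\<close>.\<close>

lemma power_add_mult_less:
  fixes A B :: int
  assumes "2 \<le> B" "B + 2 \<le> A" "0 < n" "0 < d"
  shows "(A ^ n + B ^ n) * (B ^ d - 1) < A ^ n * (A ^ d - B ^ d) * (B ^ n - 1)"
proof -
  have BA: "B ^ n < A ^ n" using assms by (intro power_strict_mono) auto
  have Bn: "B \<le> B ^ n" using assms by (simp add: self_le_power)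
  have Bd: "B \<le> B ^ d" using assms by (simp add: self_le_power)
  have BAd: "B ^ d \<le> A ^ d" using assms by (intro power_mono) auto
  have "2 * (B ^ d - 1) \<le> (A ^ d - B ^ d) * (B - 1)"
    by (rule power_diff_ge) (use assms in auto)
  also have "\<dots> \<le> (A ^ d - B ^ d) * (B ^ n - 1)"
    by (rule mult_left_mono) (use BAd Bn in auto)
  finally have "A ^ n * (2 * (B ^ d - 1)) \<le> A ^ n * ((A ^ d - B ^ d) * (B ^ n - 1))"
    using assms by (intro mult_left_mono) auto
  moreover have "(A ^ n + B ^ n) * (B ^ d - 1) < (2 * A ^ n) * (B ^ d - 1)"
    by (rule mult_strict_right_mono) (use BA Bd assms in auto)
  ultimately show ?thesis by (simp add: algebra_simps)
qed

text \<open>Excludes a first solution \<open>Y = c + X\<close> together with a last one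
  \<open>X = c + Y\<close>. Unless \<open>B ^ d = 2\<close>, \<open>B ^ d + 1\<close> is at most
  \<open>2 * (B ^ d - 1)\<close> and \<open>power_diff_ge\<close> applies.\<close>

lemma power_diff_mult_less:
  fixes A B :: int
  assumes "2 \<le> B" "B + 2 \<le> A" "0 < n" "0 < d"
  shows "(A ^ n - B ^ n) * (B ^ d + 1) < A ^ n * (A ^ d - B ^ d) * (B ^ n - 1)"
proof -
  have BA: "B ^ n < A ^ n" using assms by (intro power_strict_mono) auto
  have Bn: "B \<le> B ^ n" using assms by (simp add: self_le_power)
  have Bd: "B \<le> B ^ d" using assms by (simp add: self_le_power)
  have BAd: "B ^ d \<le> A ^ d" using assms by (intro power_mono) auto
  have Apos: "0 < A ^ n" "0 < B ^ n" using assms by auto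
  have le: "(A ^ d - B ^ d) * (B - 1) \<le> (A ^ d - B ^ d) * (B ^ n - 1)"
    by (rule mult_left_mono) (use BAd Bn in auto)
  have lt: "(A ^ n - B ^ n) * (B ^ d + 1) < A ^ n * (B ^ d + 1)"
    by (rule mult_strict_right_mono) (use Apos Bd assms in auto)
  show ?thesis
  proof (cases "B ^ d = 2")
    case False
    hence "B ^ d + 1 \<le> 2 * (B ^ d - 1)" using Bd assms by auto
    also have "\<dots> \<le> (A ^ d - B ^ d) * (B ^ n - 1)"
      using power_diff_ge[of B A d] le assms by linarith
    finally have "A ^ n * (B ^ d + 1) \<le> A ^ n * ((A ^ d - B ^ d) * (B ^ n - 1))"
      using Apos by (intro mult_left_mono) auto
    with lt show ?thesis by (simp add: mult.assoc)
  next
    case True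
    have B2: "B = 2" using Bd True assms by simp
    have d1: "d = 1"
    proof (rule ccontr)
      assume "d \<noteq> 1"
      hence "B ^ 2 \<le> B ^ d" using assms by (intro power_increasing) auto
      thus False using True B2 by simp
    qed
    \<comment> \<open>The estimate works once \<open>(A - 2) * (2 ^ n - 1)\<close> is at least 3,
      which fails only for \<open>A = 4\<close>, \<open>n = 1\<close>; there the claim reads 6 <
      8.\<close>
    show ?thesis
    proof (cases "A = 4 \<and> n = 1")
      case True
      thus ?thesis by (simp add: B2 d1)
    next
      case False
      have "3 \<le> (A - 2) * (2 ^ n - 1)"
      proof (cases "n = 1")
        case True
        thus ?thesis using False assms B2 by simp
      next
        case False
        hence "(2::int) ^ 2 \<le> 2 ^ n" using assms by (intro power_increasing) auto
        hence "2 * 3 \<le> (A - 2) * (2 ^ n - 1)" using assms B2 by (intro mult_mono) auto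
        thus ?thesis by simp
      qed
      hence "A ^ n * (B ^ d + 1) \<le> A ^ n * ((A ^ d - B ^ d) * (B ^ n - 1))"
        using Apos by (intro mult_left_mono) (auto simp: B2 d1)
      with lt show ?thesis by (simp only: mult.assoc)
    qed
  qed
qed

text \<open>The right side is below \<open>2 * A ^ n * (B ^ d + 1)\<close>; cancelling
  \<open>A ^ n\<close> leaves a bound too small for \<open>n > 1\<close>, and then for
  \<open>d > 1\<close>. What remains is a polynomial equation in \<open>A\<close> and
  \<open>B\<close>.\<close>

lemma power_diff_mult_eq_cases:
  fixes A B :: int
  assumes "2 \<le> B" "B + 2 \<le> A" "0 < n" "0 < d"
    and eq: "A ^ n * (A ^ d - B ^ d) * (B ^ n - 1) = (A ^ n + B ^ n) * (B ^ d + 1)"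
  shows "n = 1 \<and> d = 1 \<and> A = 6 \<and> (B = 2 \<or> B = 3)"
proof -
  have BA: "B ^ n < A ^ n" using assms by (intro power_strict_mono) auto
  have Bd: "B \<le> B ^ d" using assms by (simp add: self_le_power)
  have BAd: "B ^ d \<le> A ^ d" using assms by (intro power_mono) auto
  have Apos: "0 < A ^ n" using assms by auto
  have "(A ^ n + B ^ n) * (B ^ d + 1) < (2 * A ^ n) * (B ^ d + 1)"
    by (rule mult_strict_right_mono) (use BA Bd assms in auto)
  hence "A ^ n * ((A ^ d - B ^ d) * (B ^ n - 1)) < A ^ n * (2 * (B ^ d + 1))"
    using eq by (simp add: algebra_simps)
  hence upper: "(A ^ d - B ^ d) * (B ^ n - 1) < 2 * (B ^ d + 1)"
    using Apos by (simp add: mult_less_cancel_left)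
  have n: "n = 1"
  proof (rule ccontr)
    assume "n \<noteq> 1"
    hence "B ^ 2 \<le> B ^ n" using assms by (intro power_increasing) auto
    hence "(B - 1) * (B + 1) \<le> B ^ n - 1" by (simp add: algebra_simps power2_eq_square)
    hence "(A ^ d - B ^ d) * ((B - 1) * (B + 1)) \<le> (A ^ d - B ^ d) * (B ^ n - 1)"
      using BAd by (intro mult_left_mono) auto
    moreover have "2 * (B ^ d - 1) * 3 \<le> (A ^ d - B ^ d) * (B - 1) * (B + 1)"
      using assms Bd BAd by (intro mult_mono power_diff_ge) auto
    ultimately show False using upper Bd assms by (simp add: mult.assoc)
  qed
  have d: "d = 1"
    using power_diff_ge_of_ge_2[of B A d] upper n assms by (cases "2 \<le> d") auto
  \<comment> \<open>For \<open>n = d = 1\<close> the equation has the positive factor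
    \<open>A + 1\<close>; the other factor can be completed to a product equal to 2.\<close>
  have "(A + 1) * (A * (B - 1) - B * (B + 1)) = 0"
    using eq unfolding n d by (simp add: algebra_simps)
  hence "A * (B - 1) = B * (B + 1)" using assms by auto
  hence prod: "(B - 1) * (A - B - 2) = 2" by (simp add: algebra_simps)
  hence "B - 1 dvd 2" by (metis dvd_triv_left)
  hence "B - 1 \<le> 2" by (rule zdvd_imp_le) simp
  hence "B = 2 \<or> B = 3" using assms by auto
  with prod n d show ?thesis by auto
qed

text \<open>The equation without sign exponents: for positive terms and \<open>c > 0\<close>, two
  minus signs cannot occur.\<close>

definition is_solution :: "int \<Rightarrow> int \<Rightarrow> int \<Rightarrow> bool" where
  "is_solution c X Y \<longleftrightarrow> X + Y = c \<or> X = c + Y \<or> Y = c + X"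

lemma is_solution_commute: "is_solution c X Y \<longleftrightarrow> is_solution c Y X"
  by (auto simp: is_solution_def)

text \<open>The middle solution must be \<open>Y = c + X\<close>. The outer ones leave two signs
  each; eliminating \<open>c\<close> and \<open>y\<close> gives one exponential equation per sign
  pair, and inequalities exclude all pairs but one.\<close>

lemma three_solutions_on_line:
  fixes A B c x y :: int
  assumes A: "2 \<le> B" "B + 2 \<le> A" and pos: "0 < x" "0 < y" "0 < c" and nm: "0 < n" "n < m"
    and sol: "is_solution c x y" "is_solution c (x * A ^ n) (y * B ^ n)"
      "is_solution c (x * A ^ m) (y * B ^ m)"
  shows "n = 1 \<and> m = 2 \<and> A = 6 \<and>
    (B = 2 \<and> c = 8 * x \<and> y = 7 * x \<or> B = 3 \<and> 2 * c = 9 * x \<and> 2 * y = 7 * x)"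
proof -
  define d where "d = m - n"
  have d: "0 < d" "m = n + d" using nm by (auto simp: d_def)
  define X where "X = x * A ^ n"
  define Y where "Y = y * B ^ n"
  have XY: "x * A ^ m = A ^ d * X" "y * B ^ m = B ^ d * Y"
    by (simp_all add: X_def Y_def d power_add)
  have gt1: "1 < A ^ n" "1 < B ^ n" "1 < A ^ d" "1 < B ^ d"
    using A nm d by (auto intro!: one_less_power)
  have BA: "B ^ n < A ^ n" "B ^ d < A ^ d"
    using A nm d by (auto intro!: power_strict_mono)
  have big: "x < X" "y < Y" using pos gt1 by (auto simp: X_def Y_def)
  have big': "X < A ^ d * X" "Y < B ^ d * Y" using pos gt1 big by auto
  have c_le: "c \<le> x + y" using sol(1) pos by (auto simp: is_solution_def)
  \<comment> \<open>The terms have outgrown \<open>c \<le> x + y\<close>, so they cannot sum to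
    \<open>c\<close>. If \<open>X = c + Y\<close>, passing to the last solution multiplies
    \<open>X\<close> by the larger ratio, and the difference exceeds \<open>c\<close>.\<close>
  have Y: "Y = c + X"
  proof (rule ccontr)
    assume "Y \<noteq> c + X"
    hence "X = c + Y" using sol(2) big c_le by (auto simp: is_solution_def X_def Y_def)
    hence "A ^ d * X = A ^ d * c + A ^ d * Y" by (simp add: algebra_simps)
    moreover have "c < A ^ d * c" "B ^ d * Y < A ^ d * Y" using pos gt1 BA big by auto
    ultimately show False
      using sol(3) big' big pos unfolding XY is_solution_def by (elim disjE) linarith+
  qed
  \<comment> \<open>The sign \<open>e\<close> belongs to the last solution, \<open>f\<close> to the
    first; \<open>key\<close> combines the two resulting expressions for \<open>c\<close>.\<close>
  have c1: "x * A ^ n * (A ^ d - B ^ d) = c * (B ^ d + e)"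
    if "B ^ d * Y - A ^ d * X = - e * c" for e
    using that unfolding Y by (simp add: X_def algebra_simps)
  have c2: "c * (B ^ n - 1) = x * (A ^ n + f * B ^ n)"
    if "c = y + f * x" "f * f = 1" for f
  proof -
    have "x * (1 - f * f) = 0" using that by simp
    hence "y * B ^ n = y + f * x + x * A ^ n" "x = x * f * f"
      using Y that by (auto simp: X_def Y_def algebra_simps)
    thus ?thesis using that by (simp add: algebra_simps)
  qed
  have key: "A ^ n * (A ^ d - B ^ d) * (B ^ n - 1) = (A ^ n + f * B ^ n) * (B ^ d + e)"
    if "B ^ d * Y - A ^ d * X = - e * c" "c = y + f * x" "f * f = 1" for e f
  proof -
    have "x * (A ^ n * (A ^ d - B ^ d) * (B ^ n - 1)) = x * ((A ^ n + f * B ^ n) * (B ^ d + e))"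
      using c1[OF that(1)] c2[OF that(2,3)] by (metis mult.assoc mult.commute)
    thus ?thesis using pos by simp
  qed
  have first: "c = y + 1 * x \<or> c = y + (- 1) * x"
  proof -
    have "x \<noteq> c + y"
    proof
      assume "x = c + y"
      hence "y * A ^ n < X" using pos gt1 by (simp add: X_def)
      moreover have "Y < y * A ^ n" using BA pos by (simp add: Y_def)
      ultimately show False using Y pos by simp
    qed
    thus ?thesis using sol(1) by (auto simp: is_solution_def)
  qed
  have last: "B ^ d * Y - A ^ d * X = - 1 * c \<or> B ^ d * Y - A ^ d * X = - (- 1) * c"
    using sol(3) big big' c_le unfolding XY by (auto simp: is_solution_def)
  have nd: "0 < n" "0 < d" using nm d by auto
  have "B ^ d * Y - A ^ d * X = - 1 * c"
  proof (rule ccontr)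
    assume "B ^ d * Y - A ^ d * X \<noteq> - 1 * c"
    hence *: "B ^ d * Y - A ^ d * X = - (- 1) * c" using last by blast
    from first obtain f where f: "c = y + f * x" "f * f = 1" "f = 1 \<or> f = - 1" by force
    have "(A ^ n + f * B ^ n) * (B ^ d - 1) \<le> (A ^ n + B ^ n) * (B ^ d - 1)"
      using f(3) gt1 by (intro mult_right_mono) auto
    with power_add_mult_less[OF A nd] key[OF * f(1,2)] show False by simp
  qed
  note last' = this
  have "c = y + 1 * x"
  proof (rule ccontr)
    assume "c \<noteq> y + 1 * x"
    hence "c = y + (- 1) * x" using first by blast
    from power_diff_mult_less[OF A nd] key[OF last' this] show False by simp
  qed
  note first' = this
  have "n = 1 \<and> d = 1 \<and> A = 6 \<and> (B = 2 \<or> B = 3)"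
    using key[OF last' first'] by (intro power_diff_mult_eq_cases[OF A nd]) simp
  thus ?thesis using c2[OF first'] first' d by auto
qed

section \<open>Elementary facts on powers, chains and valuations\<close>

text \<open>Division by the gcd makes the coefficients coprime, so every solution is a multiple of
  the primitive one.\<close>

lemma nat_mult_eq_param:
  fixes m k \<alpha> \<beta> :: nat
  assumes eq: "m * \<alpha> = k * \<beta>" and pos: "0 < \<alpha>" "0 < \<beta>"
  shows "\<exists>n. m = n * (\<beta> div gcd \<alpha> \<beta>) \<and> k = n * (\<alpha> div gcd \<alpha> \<beta>)"
proof -
  define g where "g = gcd \<alpha> \<beta>"
  define \<alpha>' where "\<alpha>' = \<alpha> div g"
  define \<beta>' where "\<beta>' = \<beta> div g"
  have g: "0 < g" "\<alpha> = \<alpha>' * g" "\<beta> = \<beta>' * g"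
    using pos by (auto simp: g_def \<alpha>'_def \<beta>'_def)
  have co: "coprime \<alpha>' \<beta>'"
    using pos unfolding \<alpha>'_def \<beta>'_def g_def by (intro div_gcd_coprime) auto
  have eq': "m * \<alpha>' = k * \<beta>'" using eq g by simp
  hence "\<beta>' dvd m * \<alpha>'" by simp
  hence "\<beta>' dvd m" using co by (simp add: coprime_commute coprime_dvd_mult_left_iff)
  then obtain n where n: "m = n * \<beta>'" by (metis dvdE mult.commute)
  have "0 < \<beta>'" using g pos by (cases \<beta>') auto
  hence "k = n * \<alpha>'" using eq' n by simp
  thus ?thesis using n unfolding \<alpha>'_def \<beta>'_def g_def by blast
qed

text \<open>An exponent of at least 2 would need \<open>a\<^sup>2 \<le> 6\<close>, hence
  \<open>a = 2\<close>, and then \<open>n = 4\<close>.\<close>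

lemma power_eq_2_3_6:
  fixes a :: int
  assumes "2 \<le> a" "a ^ i = n" "n = 2 \<or> n = 3 \<or> n = 6"
  shows "i = 1 \<and> a = n"
proof -
  have "i \<noteq> 0" using assms by (cases i) auto
  moreover have "\<not> 2 \<le> i"
  proof
    assume i: "2 \<le> i"
    hence "a\<^sup>2 \<le> n" using assms power_increasing[of 2 i a] by simp
    hence "a < 3" using assms power_mono[of 3 a 2] by (cases "a < 3") auto
    hence a: "a = 2" using assms by simp
    have "i < 3" using assms a power_increasing[of 3 i "2::int"] by (cases "i < 3") auto
    hence "i = 2" using i by simp
    thus False using a assms by auto
  qed
  ultimately have "i = 1" by simp
  thus ?thesis using assms by simp
qed

text \<open>Infinite sets have \<open>card\<close> 0, so "more than \<open>n\<close> elements" is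
  written as a negation that includes finiteness.\<close>

lemma ex_increasing_list:
  fixes D :: "nat set"
  assumes "\<not> (finite D \<and> card D \<le> n)"
  shows "\<exists>xs. sorted_wrt (<) xs \<and> length xs = Suc n \<and> set xs \<subseteq> D"
proof -
  obtain T where T: "T \<subseteq> D" "finite T" "card T = Suc n"
  proof (cases "finite D")
    case True
    with assms have "Suc n \<le> card D" by simp
    then obtain T where "T \<subseteq> D" "card T = Suc n" by (metis obtain_subset_with_card_n)
    with that True finite_subset show ?thesis by blast
  next
    case False
    then obtain T where "finite T" "card T = Suc n" "T \<subseteq> D"
      using infinite_arbitrarily_large by blast
    with that show ?thesis by blast
  qed
  thus ?thesis
    by (intro exI[of _ "sorted_list_of_set T"]) (auto simp: strict_sorted_list_of_set)
qed

lemma ex_increasing_3: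
  fixes D :: "nat set"
  assumes "\<not> (finite D \<and> card D \<le> 2)"
  obtains x y z where "x \<in> D" "y \<in> D" "z \<in> D" "x < y" "y < z"
  using ex_increasing_list[OF assms] by (auto simp: length_Suc_conv numeral_2_eq_2)

lemma ex_increasing_4:
  fixes D :: "nat set"
  assumes "\<not> (finite D \<and> card D \<le> 3)"
  obtains w x y z where "w \<in> D" "x \<in> D" "y \<in> D" "z \<in> D" "w < x" "x < y" "y < z"
  using ex_increasing_list[OF assms] by (auto simp: length_Suc_conv numeral_3_eq_3)

section \<open>Terms of the equation and their p-adic valuations\<close>

definition geom :: "int \<Rightarrow> int \<Rightarrow> nat \<Rightarrow> int" where
  "geom r a n = r * a ^ n"

lemma geom_add: "geom r a (m + n) = geom r a m * a ^ n"
  by (simp add: geom_def power_add)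

lemma geom_pos: "0 < r \<Longrightarrow> 1 < a \<Longrightarrow> 0 < geom r a n"
  by (simp add: geom_def)

lemma geom_mono: "0 < r \<Longrightarrow> 1 < a \<Longrightarrow> m \<le> n \<Longrightarrow> geom r a m \<le> geom r a n"
  by (simp add: geom_def)

lemma geom_eq_iff: "0 < r \<Longrightarrow> 1 < a \<Longrightarrow> geom r a m = geom r a n \<longleftrightarrow> m = n"
  by (simp add: geom_def)

lemma geom_eq_mult:
  assumes "m \<le> n"
  shows "geom r a n = geom r a m * a ^ (n - m)"
  using assms geom_add[of r a m "n - m"] by simp

lemma geom_double:
  assumes "0 < r" "1 < a" "m < n"
  shows "2 * geom r a m \<le> geom r a n"
proof -
  have "2 \<le> a ^ (n - m)" using assms self_le_power[of a "n - m"] by linarith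
  hence "geom r a m * 2 \<le> geom r a m * a ^ (n - m)"
    using geom_pos[of r a m] assms by (intro mult_left_mono) auto
  thus ?thesis using assms geom_eq_mult[of m n r a] by simp
qed

lemma multiplicity_geom:
  assumes "prime p" "0 < r" "1 < a"
  shows "multiplicity p (geom r a n) = multiplicity p r + n * multiplicity p a"
proof -
  have "prime_elem p" "a \<noteq> 0" "r \<noteq> 0" using assms by auto
  thus ?thesis
    by (simp add: geom_def prime_elem_multiplicity_mult_distrib prime_elem_multiplicity_power_distrib)
qed

lemma multiplicity_pos:
  fixes a p :: int
  assumes "prime p" "1 < a" "p dvd a"
  shows "0 < multiplicity p a"
  using assms by (subst prime_multiplicity_gt_zero_iff) auto

lemma multiplicity_geom_less_iff:
  assumes "prime p" "0 < r" "1 < a" "p dvd a"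
  shows "multiplicity p (geom r a m) < multiplicity p (geom r a n) \<longleftrightarrow> m < n"
  using multiplicity_pos[of p a] assms by (simp add: multiplicity_geom)

lemma multiplicity_geom_eq_iff:
  assumes "prime p" "0 < r" "1 < a" "p dvd a"
  shows "multiplicity p (geom r a m) = multiplicity p (geom r a n) \<longleftrightarrow> m = n"
  using multiplicity_pos[of p a] assms by (simp add: multiplicity_geom)

lemma multiplicity_minus_int: "multiplicity p (- x) = multiplicity p (x :: int)"
  by (rule multiplicity_cong) simp

text \<open>Ultrametric principle: if two valuations differ, the sum has the smaller one.\<close>

lemma multiplicity_sum_cases:
  fixes x y :: int
  assumes "x \<noteq> 0" "y \<noteq> 0"
  shows "multiplicity p x = multiplicity p y \<or>
    multiplicity p x = multiplicity p (x + y) \<and> multiplicity p (x + y) < multiplicity p y \<or>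
    multiplicity p y = multiplicity p (x + y) \<and> multiplicity p (x + y) < multiplicity p x"
  using multiplicity_sum_lt[of p x y] multiplicity_sum_lt[of p y x] assms
  by (cases "multiplicity p x" "multiplicity p y" rule: linorder_cases) (auto simp: add.commute)

section \<open>Classification of solutions by a common prime\<close>

locale common_prime =
  fixes a b c r s p :: int
  assumes a: "1 < a" and b: "1 < b" and c: "0 < c" and r: "0 < r" and s: "0 < s"
    and p: "prime p" "p dvd a" "p dvd b"
begin

abbreviation X where "X \<equiv> geom r a"
abbreviation Y where "Y \<equiv> geom s b"
abbreviation v where "v \<equiv> multiplicity p"

lemmas X_pos = geom_pos[OF r a] and Y_pos = geom_pos[OF s b]
lemmas X_mono = geom_mono[OF r a] and Y_mono = geom_mono[OF s b]
lemmas X_double = geom_double[OF r a] and Y_double = geom_double[OF s b]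
lemmas X_eq_iff = geom_eq_iff[OF r a] and Y_eq_iff = geom_eq_iff[OF s b]
lemmas v_X = multiplicity_geom[OF p(1) r a] and v_Y = multiplicity_geom[OF p(1) s b]
lemmas v_X_less_iff = multiplicity_geom_less_iff[OF p(1) r a p(2)]
  and v_Y_less_iff = multiplicity_geom_less_iff[OF p(1) s b p(3)]
lemmas v_X_eq_iff = multiplicity_geom_eq_iff[OF p(1) r a p(2)]
  and v_Y_eq_iff = multiplicity_geom_eq_iff[OF p(1) s b p(3)]

definition balanced where
  "balanced x y \<longleftrightarrow> is_solution c (X x) (Y y) \<and> v (X x) = v (Y y)"

definition left where
  "left x y \<longleftrightarrow> is_solution c (X x) (Y y) \<and> v (X x) = v c \<and> v c < v (Y y)"

definition right where
  "right x y \<longleftrightarrow> is_solution c (X x) (Y y) \<and> v (Y y) = v c \<and> v c < v (X x)"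

text \<open>The exchange of the two terms turns left solutions into right ones, so each result on
  one type transfers to the other.\<close>

lemma swap: "common_prime b a c s r p"
  using a b c r s p by unfold_locales

lemma solution_cases:
  assumes "is_solution c (X x) (Y y)"
  shows "balanced x y \<or> left x y \<or> right x y"
proof -
  have "X x \<noteq> 0" "Y y \<noteq> 0" using X_pos[of x] Y_pos[of y] by auto
  hence "v (X x) = v (Y y) \<or> v (X x) = v c \<and> v c < v (Y y) \<or> v (Y y) = v c \<and> v c < v (X x)"
    using assms multiplicity_sum_cases[of "X x" "Y y" p] multiplicity_sum_cases[of "X x" "- Y y" p]
      multiplicity_sum_cases[of "- X x" "Y y" p]
    by (auto simp: is_solution_def multiplicity_minus_int)
  thus ?thesis using assms by (auto simp: balanced_def left_def right_def)
qed

text \<open>Serves to bound the exponents of balanced solutions by those of left and right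
  ones.\<close>

lemma balanced_le:
  assumes "balanced x y"
  shows "v (X x) \<le> v c"
proof (rule multiplicity_geI)
  have X: "p ^ v (X x) dvd X x" and Y: "p ^ v (X x) dvd Y y"
    using assms multiplicity_dvd[of p "X x"] multiplicity_dvd[of p "Y y"]
    by (simp_all add: balanced_def)
  have "c = X x + Y y \<or> c = X x - Y y \<or> c = Y y - X x"
    using assms by (auto simp: balanced_def is_solution_def)
  thus "p ^ v (X x) dvd c" using X Y by auto
qed (use c p in auto)

lemma balanced_x_less_iff:
  assumes "balanced x1 y1" "balanced x2 y2"
  shows "x1 < x2 \<longleftrightarrow> y1 < y2"
  using assms v_X_less_iff[of x1 x2] v_Y_less_iff[of y1 y2] by (simp add: balanced_def)

text \<open>Both solutions share \<open>X\<close>, because its valuation is \<open>v c\<close>. The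
  larger \<open>Y\<close> must be \<open>c + X\<close> and the smaller is the distance of
  \<open>c\<close> and \<open>X\<close>, so the two determine \<open>c\<close> and \<open>X\<close>
  up to order.\<close>

lemma left_pair:
  assumes L: "left x y'" "left x' y" and less: "y' < y"
  shows "x' = x" "p = 2" "v (Y y') = Suc (v c)" "Y y = c + X x"
    "2 * c = Y y' * (b ^ (y - y') + 1) \<and> 2 * X x = Y y' * (b ^ (y - y') - 1) \<or>
     2 * c = Y y' * (b ^ (y - y') - 1) \<and> 2 * X x = Y y' * (b ^ (y - y') + 1)"
proof -
  show x': "x' = x" using L v_X_eq_iff[of x' x] by (simp add: left_def)
  have lt: "Y y' < Y y" using Y_double[OF less] Y_pos[of y'] by simp
  have sol: "is_solution c (X x) (Y y)" "is_solution c (X x) (Y y')"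
    using L x' by (auto simp: left_def)
  show Y: "Y y = c + X x"
    using sol lt c Y_pos[of y] Y_pos[of y'] X_pos[of x] unfolding is_solution_def
    by (elim disjE) linarith+
  have Y': "Y y' = c - X x \<or> Y y' = X x - c"
    using sol(2) lt Y by (auto simp: is_solution_def)
  have Yb: "Y y = Y y' * b ^ (y - y')" using less by (simp add: geom_eq_mult)
  show "2 * c = Y y' * (b ^ (y - y') + 1) \<and> 2 * X x = Y y' * (b ^ (y - y') - 1) \<or>
     2 * c = Y y' * (b ^ (y - y') - 1) \<and> 2 * X x = Y y' * (b ^ (y - y') + 1)"
    using Y Y' Yb by (auto simp: algebra_simps)
  \<comment> \<open>The sum is \<open>2 * c\<close> or \<open>2 * X x\<close>, of valuation
    \<open>v 2 + v c\<close>; as \<open>v (Y y')\<close> exceeds \<open>v c\<close>, the prime must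
    divide 2.\<close>
  have "v (Y y' + Y y) = v (Y y')"
    using v_Y_less_iff[of y' y] less Y_pos[of y] Y_pos[of y'] by (intro multiplicity_sum_lt) auto
  moreover have "Y y' + Y y = 2 * c \<or> Y y' + Y y = 2 * X x" using Y Y' by auto
  moreover have "v (2 * c) = v 2 + v c" "v (2 * X x) = v 2 + v (X x)"
    using p c X_pos[of x] by (auto intro!: prime_elem_multiplicity_mult_distrib)
  ultimately have v: "v (Y y') = v 2 + v c" using L by (auto simp: left_def)
  hence "0 < v 2" using L by (simp add: left_def)
  hence "p dvd 2" by (metis not_dvd_imp_multiplicity_0 less_irrefl)
  thus "p = 2" using p(1) using primes_dvd_imp_eq[of p 2] by simp
  thus "v (Y y') = Suc (v c)" using v by simp
qed

text \<open>The left pair expresses \<open>c\<close> and \<open>X x0\<close> through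
  \<open>w = Y y0\<close>. Substituting them into the right solution gives first a divisibility for
  \<open>b\<close>, then an equation in the two ratios \<open>B\<close> and
  \<open>E\<close>.\<close>

lemma left_left_right:
  assumes L: "left x0 y'" "left x0' y" "y' < y" and R: "right x y0"
  shows "b = 2 \<and> (X x0 = Y y0 \<and> c = 3 * Y y0 \<or> X x0 = 3 * Y y0 \<and> c = 5 * Y y0)"
proof -
  note pair = left_pair[OF L]
  \<comment> \<open>\<open>Y y'\<close> has valuation one more than \<open>c\<close>, and
    \<open>Y y0\<close> has that of \<open>c\<close>. The product being 1 also rules out truncated
    subtraction.\<close>
  have "(y' - y0) * v b = 1" using pair(3) R by (auto simp: right_def v_Y diff_mult_distrib)
  hence "y' - y0 = 1" by simp
  hence "y' = y0 + 1" by simp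
  hence Y': "Y y' = Y y0 * b" by (simp add: geom_def)
  define B where "B = b ^ (y - y')"
  define E where "E = a ^ (x - x0)"
  define w where "w = Y y0"
  have w: "0 < w" using Y_pos by (simp add: w_def)
  have "x0 < x" using L(1) R v_X_less_iff[of x0 x] by (simp add: left_def right_def)
  hence X: "X x = X x0 * E" by (simp add: geom_eq_mult E_def)
  have E: "2 \<le> E" using a \<open>x0 < x\<close> self_le_power[of a "x - x0"] unfolding E_def by linarith
  have B: "2 \<le> B" using b L(3) self_le_power[of b "y - y'"] unfolding B_def by linarith
  have sol: "is_solution c (X x0 * E) w" using R by (simp add: right_def X w_def)
  have eqs: "2 * c = w * b * (B + 1) \<and> 2 * X x0 = w * b * (B - 1) \<or>
      2 * c = w * b * (B - 1) \<and> 2 * X x0 = w * b * (B + 1)"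
    using pair(5) unfolding Y' B_def w_def by simp
  define z where "z = X x0 * E"
  \<comment> \<open>\<open>2 * w\<close> is a signed sum of \<open>2 * c\<close> and
    \<open>2 * z\<close>, both multiples of \<open>w * b\<close>.\<close>
  have "2 * w = 2 * c - 2 * z \<or> 2 * w = 2 * z - 2 * c \<or> 2 * w = 2 * c + 2 * z"
    using sol unfolding is_solution_def z_def[symmetric] by presburger
  moreover have "w * b dvd 2 * c" "w * b dvd 2 * X x0" using eqs by auto
  moreover from this have "w * b dvd 2 * z" by (simp add: z_def flip: mult.assoc)
  ultimately have "w * b dvd w * 2" by (metis dvd_add dvd_diff mult.commute)
  hence "b dvd 2" using w by simp
  hence b2: "b = 2" using b zdvd_imp_le[of b 2] by simp
  have eqs': "c = w * (B + 1) \<and> X x0 = w * (B - 1) \<or> c = w * (B - 1) \<and> X x0 = w * (B + 1)"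
    using eqs by (simp add: b2)
  thus ?thesis
  proof
    assume eq: "c = w * (B + 1) \<and> X x0 = w * (B - 1)"
    \<comment> \<open>Dividing by \<open>w\<close> leaves \<open>(B - 1) * E = B\<close> or
      \<open>B + 2\<close>. Since \<open>E \<ge> 2\<close>, \<open>B\<close> is at most 4, and
      parity excludes \<open>B = 3\<close>.\<close>
    have "w * ((B - 1) * E) + w = w * (B + 1) \<or> w * ((B - 1) * E) = w * (B + 1) + w \<or>
        w = w * (B + 1) + w * ((B - 1) * E)"
      using sol eq by (simp add: is_solution_def mult.assoc)
    hence "w * ((B - 1) * E) = w * B \<or> w * ((B - 1) * E) = w * (B + 2) \<or>
        w * (B + (B - 1) * E) = w * 0"
      by (auto simp: algebra_simps)
    hence "(B - 1) * E = B \<or> (B - 1) * E = B + 2 \<or> B + (B - 1) * E = 0"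
      using w by (metis less_irrefl mult_left_cancel)
    moreover have le: "(B - 1) * 2 \<le> (B - 1) * E" using B E by (intro mult_left_mono) auto
    ultimately have E': "(B - 1) * E = B \<or> (B - 1) * E = B + 2" using B by auto
    hence "B \<le> 4" using le by auto
    hence "B = 2 \<or> B = 3 \<or> B = 4" using B by auto
    moreover have "B \<noteq> 3"
    proof
      assume "B = 3"
      hence "2 * E = 3 \<or> 2 * E = 5" using E' by simp
      thus False by presburger
    qed
    ultimately show ?thesis using eq b2 unfolding w_def by auto
  next
    assume eq: "c = w * (B - 1) \<and> X x0 = w * (B + 1)"
    \<comment> \<open>The left term of the right solution would exceed \<open>c + w\<close>, the
      largest value compatible with the other term \<open>w\<close>.\<close>
    have "w * (B + 1) * 2 \<le> X x0 * E" using eq B E w by (intro mult_mono) auto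
    moreover have "0 < B * w" using w B by simp
    hence "c + w < w * (B + 1) * 2" using eq w by (simp add: algebra_simps)
    ultimately have False
      using sol c w unfolding is_solution_def by (elim disjE) linarith+
    thus ?thesis ..
  qed
qed

text \<open>By valuations the balanced terms are at most \<open>X x0\<close> and
  \<open>Y y0\<close>, so \<open>c \<le> X x0 + Y y0\<close>; \<open>left_left_right\<close> gives 3
  against 2 or 5 against 4 multiples of \<open>Y y0\<close>.\<close>

lemma not_left_left_right_balanced:
  assumes "left x0 y'" "left x0' y" "y' < y" "right x y0" "balanced x1 y1"
  shows False
proof -
  have "v (X x1) \<le> v (X x0)" "v (Y y1) \<le> v (Y y0)"
    using balanced_le[OF assms(5)] assms by (auto simp: left_def right_def balanced_def)
  hence "x1 \<le> x0" "y1 \<le> y0" using v_X_less_iff[of x0 x1] v_Y_less_iff[of y0 y1] by auto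
  hence "X x1 \<le> X x0" "Y y1 \<le> Y y0" by (auto intro: X_mono Y_mono)
  moreover have "c \<le> X x1 + Y y1"
    using assms(5) X_pos[of x1] Y_pos[of y1] by (auto simp: balanced_def is_solution_def)
  ultimately show False using left_left_right[OF assms(1-4)] Y_pos[of y0] by auto
qed

lemma balanced_double:
  assumes "balanced x1 y1" "balanced x2 y2" "x1 < x2"
  shows "2 * X x1 \<le> X x2" "2 * Y y1 \<le> Y y2" "c \<le> X x1 + Y y1"
  using assms X_double[of x1 x2] Y_double[of y1 y2] balanced_x_less_iff[OF assms(1,2)]
    X_pos[of x1] Y_pos[of y1]
  by (auto simp: balanced_def is_solution_def)

text \<open>Adding the bounds gives
  \<open>X x0 + Y y0 \<le> 2 * c \<le> X x2 + Y y2 \<le> X x0 + Y y0\<close>. Equality throughout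
  makes both terms of the second balanced solution equal to \<open>c\<close>, which no solution
  allows.\<close>

lemma not_balanced_balanced_left_right:
  assumes "balanced x1 y1" "balanced x2 y2" "x1 < x2" "left x0 y" "right x y0"
  shows False
proof -
  note d = balanced_double[OF assms(1-3)]
  have "v (X x2) \<le> v (X x0)" "v (Y y2) \<le> v (Y y0)"
    using balanced_le[OF assms(2)] assms by (auto simp: left_def right_def balanced_def)
  hence "x2 \<le> x0" "y2 \<le> y0" using v_X_less_iff[of x0 x2] v_Y_less_iff[of y0 y2] by auto
  hence le: "X x2 \<le> X x0" "Y y2 \<le> Y y0" by (auto intro: X_mono Y_mono)
  have "v (X x0) < v (X x)" "v (Y y0) < v (Y y)"
    using assms(4,5) by (auto simp: left_def right_def)
  hence "2 * X x0 \<le> X x" "2 * Y y0 \<le> Y y"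
    using X_double Y_double v_X_less_iff v_Y_less_iff by auto
  moreover have "X x \<le> Y y0 + c" "Y y \<le> X x0 + c"
    using assms(4,5) c X_pos[of x0] Y_pos[of y0] by (auto simp: left_def right_def is_solution_def)
  moreover have "is_solution c (X x2) (Y y2)" using assms(2) by (simp add: balanced_def)
  ultimately show False
    using d le c unfolding is_solution_def by (elim disjE) linarith+
qed

text \<open>All terms are compared with \<open>w = Y y2\<close>. The balanced pair forces
  \<open>c \<le> 2 * w\<close>, which leaves few values for the ratios \<open>L\<close> and
  \<open>B\<close> of the left pair.\<close>

lemma balanced_balanced_left_left:
  assumes "balanced x1 y1" "balanced x2 y2" "x1 < x2" "left x0 y'" "left x0' y" "y' < y"
  shows "a = 2" "b = 2" "c = 4 * Y y1" "X x1 = 3 * Y y1"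
    "x2 = x1 + 1" "y2 = y1 + 1" "x0 = x1 + 2" "y' = y1 + 3" "y = y1 + 4"
proof -
  note d = balanced_double[OF assms(1-3)] and pair = left_pair[OF assms(4-6)]
  have vx: "v (X x2) \<le> v (X x0)" "v (Y y2) < v (Y y')"
    using balanced_le[OF assms(2)] assms by (auto simp: left_def balanced_def)
  hence le: "x2 \<le> x0" "y2 < y'"
    using v_X_less_iff[of x0 x2] v_Y_less_iff[of y2 y'] by auto
  define L where "L = b ^ (y' - y2)"
  define B where "B = b ^ (y - y')"
  define E where "E = a ^ (x0 - x2)"
  have X0: "X x0 = X x2 * E" and Y': "Y y' = Y y2 * L"
    using le by (simp_all add: geom_eq_mult E_def L_def)
  have pb: "even b" using p(3) pair(2) by simp
  have ev: "even L" "even B" using pb le assms(6) by (simp_all add: L_def B_def)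
  have Bb: "b \<le> B" using b assms(6) self_le_power[of b "y - y'"] by (simp add: B_def)
  have Lb: "b \<le> L" using b le self_le_power[of b "y' - y2"] by (simp add: L_def)
  define w where "w = Y y2"
  have w: "0 < w" using Y_pos by (simp add: w_def)
  have sol: "is_solution c (X x2) w" using assms(2) by (simp add: balanced_def w_def)
  have eqs: "2 * c = w * (L * (B + 1)) \<and> 2 * X x0 = w * (L * (B - 1)) \<or>
      2 * c = w * (L * (B - 1)) \<and> 2 * X x0 = w * (L * (B + 1))"
    using pair(5) unfolding Y' B_def w_def by (simp add: mult.assoc)
  have "1 * 2 \<le> (B - 1) * L" "3 * 2 \<le> (B + 1) * L"
    using Bb Lb b by (intro mult_mono; simp)+
  hence LB: "2 \<le> L * (B - 1)" "6 \<le> L * (B + 1)" by (simp_all add: mult.commute)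
  have "w * 2 \<le> 2 * c"
  proof -
    have "w * 2 \<le> w * (L * (B - 1))" "w * 2 \<le> w * (L * (B + 1))"
      using LB w by (auto intro!: mult_left_mono)
    thus ?thesis using eqs by auto
  qed
  \<comment> \<open>\<open>balanced_double\<close> gives \<open>2 * c \<le> X x2 + w\<close>; with
    \<open>w \<le> c\<close> the other two sign patterns fail.\<close>
  hence X2: "X x2 = c + w" and cw: "c \<le> 2 * w"
    using sol d w c X_pos[of x2] unfolding w_def is_solution_def by auto
  have eq: "2 * c = w * (L * (B - 1))" "2 * X x0 = w * (L * (B + 1))"
  proof -
    have "w * 6 \<le> w * (L * (B + 1))" using LB w by (intro mult_left_mono) auto
    hence "2 * c \<noteq> w * (L * (B + 1))" using cw w by linarith
    thus "2 * c = w * (L * (B - 1))" "2 * X x0 = w * (L * (B + 1))" using eqs by auto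
  qed
  have "w * (L * (B - 1)) \<le> w * 4" using eq cw by simp
  hence LB4: "L * (B - 1) \<le> 4" using w by simp
  \<comment> \<open>Both factors involve even ratios, so \<open>L * (B - 1) \<le> 4\<close> leaves
    \<open>B = 2\<close> and \<open>L\<close> in {2, 4}; the value 2 would give
    \<open>2 * E = 3\<close>.\<close>
  have B2: "B = 2"
  proof (rule ccontr)
    assume "B \<noteq> 2"
    hence "4 \<le> B" using ev Bb b by presburger
    hence "2 * 3 \<le> L * (B - 1)" using Lb b by (intro mult_mono) auto
    thus False using LB4 by simp
  qed
  hence "y - y' = 1 \<and> b = 2" using b by (intro power_eq_2_3_6) (auto simp: B_def)
  hence yb: "y = y' + 1" "b = 2" by auto
  have "L = 2 \<or> L = 4" using LB4 LB ev B2 by auto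
  moreover have "L \<noteq> 2"
  proof
    assume "L = 2"
    hence "c = w" "X x0 = w * 3" using eq B2 by auto
    hence "w * (2 * E) = w * 3" using X0 X2 by (simp add: algebra_simps)
    hence "2 * E = 3" using w by simp
    thus False by presburger
  qed
  ultimately have L4: "L = 4" by blast
  hence c2: "c = 2 * w" "X x0 = 6 * w" using eq B2 by auto
  hence "w * (3 * E) = w * 6" using X0 X2 by (simp add: algebra_simps)
  hence "E = 2" using w by simp
  hence "x0 - x2 = 1 \<and> a = 2" using a by (intro power_eq_2_3_6) (auto simp: E_def)
  hence xa: "x0 = x2 + 1" "a = 2" by auto
  have "(2::int) ^ (y' - y2) = 2 ^ 2" using L4 yb by (simp add: L_def)
  hence "y' - y2 = 2" by (simp only: power_inject_exp)
  hence y'2: "y' = y2 + 2" by simp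
  \<comment> \<open>Here \<open>X x2 + Y y2 = 2 * c\<close>, so all three bounds of
    \<open>balanced_double\<close> are equalities.\<close>
  have half: "X x2 = 2 * X x1" "Y y2 = 2 * Y y1" using d X2 c2 by (auto simp: w_def)
  have "X x2 = X (x1 + 1)" "Y y2 = Y (y1 + 1)" using half xa yb by (simp_all add: geom_def)
  hence xy: "x2 = x1 + 1" "y2 = y1 + 1" by (simp_all add: X_eq_iff Y_eq_iff)
  show "a = 2" "b = 2" "c = 4 * Y y1" "X x1 = 3 * Y y1"
    "x2 = x1 + 1" "y2 = y1 + 1" "x0 = x1 + 2" "y' = y1 + 3" "y = y1 + 4"
    using xa yb c2 half X2 xy y'2 by (auto simp: w_def)
qed

end

text \<open>The two outcomes of \<open>three_solutions_on_line\<close>, with \<open>x\<close>,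
  \<open>y\<close> the terms of the first solution and denominators cleared.\<close>

definition triple_shape :: "int \<Rightarrow> int \<Rightarrow> int \<Rightarrow> int \<Rightarrow> int \<Rightarrow> bool" where
  "triple_shape a b c x y \<longleftrightarrow>
     a = 6 \<and> (b = 2 \<and> c = 8 * x \<and> y = 7 * x \<or> b = 3 \<and> 2 * c = 9 * x \<and> 2 * y = 7 * x)"

text \<open>After the first solution the sum of the terms exceeds \<open>c\<close>, so
  \<open>c\<close> is their difference, which scales with the common ratio.\<close>

lemma not_three_solutions_same_ratio:
  fixes x y c T U :: int
  assumes "0 < x" "0 < y" "1 < T" "T < U"
    and "is_solution c x y" "is_solution c (x * T) (y * T)" "is_solution c (x * U) (y * U)" "0 < c"
  shows False
proof -
  have "c \<le> x + y" "0 < c" using assms(1,2,5,8) by (auto simp: is_solution_def)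
  have *: "c = V * \<bar>x - y\<bar>" if "1 < V" "is_solution c (x * V) (y * V)" for V
  proof -
    have "x < x * V" "y < y * V" using assms that by auto
    hence "x * V + y * V \<noteq> c" using \<open>c \<le> x + y\<close> by linarith
    hence "c = V * (x - y) \<or> c = V * (y - x)"
      using that(2) by (auto simp: is_solution_def right_diff_distrib mult.commute)
    moreover have "V * \<bar>x - y\<bar> = \<bar>V * (x - y)\<bar>" using that by (simp add: abs_mult)
    moreover have "V * (y - x) = - (V * (x - y))" by (simp add: right_diff_distrib)
    ultimately show ?thesis using \<open>0 < c\<close> by linarith
  qed
  have "T * \<bar>x - y\<bar> = U * \<bar>x - y\<bar>" using *[of T] *[of U] assms by simp
  moreover have "\<bar>x - y\<bar> \<noteq> 0" using *[of T] assms by auto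
  ultimately show False using assms by simp
qed

lemma mem_solution_pairs_iff:
  "(x, y) \<in> solution_pairs a b c r s \<longleftrightarrow> (\<exists>u v. (x, y, u, v) \<in> solutions a b c r s)"
  unfolding solution_pairs_def by force

section \<open>Counting the solutions of each type\<close>

context common_prime
begin

text \<open>Equal valuations put \<open>(x, y)\<close> on a line with slope
  \<open>v a / v b\<close>; differences are multiples of its primitive vector.\<close>

lemma balanced_param:
  assumes "balanced x1 y1" "balanced x2 y2" "x1 < x2"
  shows "\<exists>n>0. x2 = x1 + n * (v b div gcd (v a) (v b)) \<and> y2 = y1 + n * (v a div gcd (v a) (v b))"
proof -
  have y: "y1 < y2" using balanced_x_less_iff[OF assms(1,2)] assms(3) by simp
  have eq: "v r + x1 * v a = v s + y1 * v b" "v r + x2 * v a = v s + y2 * v b"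
    using assms by (simp_all add: balanced_def v_X v_Y)
  obtain m k where mk: "x2 = x1 + m" "y2 = y1 + k" "0 < m"
    using assms(3) y by (metis less_imp_add_positive)
  have "m * v a = k * v b" using eq mk by (simp add: algebra_simps)
  then obtain n where n: "m = n * (v b div gcd (v a) (v b))" "k = n * (v a div gcd (v a) (v b))"
    using nat_mult_eq_param multiplicity_pos[OF p(1) a p(2)] multiplicity_pos[OF p(1) b p(3)]
    by blast
  moreover have "0 < n" using n mk by (cases n) auto
  ultimately show ?thesis using mk by blast
qed

lemma three_balanced:
  assumes bal: "balanced x1 y1" "balanced x2 y2" "balanced x3 y3" and less: "x1 < x2" "x2 < x3"
  shows "x2 = x1 + 1 \<and> y2 = y1 + 1 \<and> x3 = x1 + 2 \<and> y3 = y1 + 2 \<and>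
    (triple_shape a b c (X x1) (Y y1) \<or> triple_shape b a c (Y y1) (X x1))"
proof -
  define \<alpha> where "\<alpha> = v a div gcd (v a) (v b)"
  define \<beta> where "\<beta> = v b div gcd (v a) (v b)"
  obtain n where n: "0 < n" "x2 = x1 + n * \<beta>" "y2 = y1 + n * \<alpha>"
    using balanced_param[OF bal(1,2) less(1)] unfolding \<alpha>_def \<beta>_def by blast
  obtain m where m: "0 < m" "x3 = x1 + m * \<beta>" "y3 = y1 + m * \<alpha>"
    using balanced_param[OF bal(1,3)] less unfolding \<alpha>_def \<beta>_def by auto
  have nm: "n < m" using less n m by simp
  have "v a \<noteq> 0" "v b \<noteq> 0"
    using multiplicity_pos[OF p(1) a p(2)] multiplicity_pos[OF p(1) b p(3)] by auto
  hence \<alpha>\<beta>: "0 < \<alpha>" "0 < \<beta>" by (auto simp: \<alpha>_def \<beta>_def div_greater_zero_iff gcd_le1_nat gcd_le2_nat)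
  define A where "A = a ^ \<beta>"
  define B where "B = b ^ \<alpha>"
  have A2: "2 \<le> A" and B2: "2 \<le> B"
    using self_le_power[of a \<beta>] self_le_power[of b \<alpha>] a b \<alpha>\<beta> unfolding A_def B_def by linarith+
  have "p dvd A" "p dvd B" using p \<alpha>\<beta> by (auto simp: A_def B_def intro: dvd_trans[OF _ dvd_power])
  \<comment> \<open>Distinct ratios differ by a multiple of \<open>p\<close>, hence by at least
    2.\<close>
  hence "p dvd A - B" "p dvd B - A" by auto
  hence gap: "B < A \<Longrightarrow> B + 2 \<le> A" "A < B \<Longrightarrow> A + 2 \<le> B"
    using zdvd_imp_le[of p "A - B"] zdvd_imp_le[of p "B - A"] prime_ge_2_int[OF p(1)] by auto
  have X: "X x2 = X x1 * A ^ n" "X x3 = X x1 * A ^ m"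
    and Y: "Y y2 = Y y1 * B ^ n" "Y y3 = Y y1 * B ^ m"
    using n m by (simp_all add: geom_add A_def B_def mult.commute flip: power_mult)
  have sol: "is_solution c (X x1) (Y y1)" "is_solution c (X x1 * A ^ n) (Y y1 * B ^ n)"
    "is_solution c (X x1 * A ^ m) (Y y1 * B ^ m)"
    using bal X Y by (simp_all add: balanced_def)
  have AB: "A \<noteq> B"
  proof
    assume AB: "A = B"
    have "1 < A ^ n" "A ^ n < A ^ m" using A2 n nm by (auto intro: one_less_power)
    thus False using not_three_solutions_same_ratio[OF X_pos Y_pos _ _ sol(1) _ _ c] sol AB by blast
  qed
  have key: "n = 1 \<and> m = 2 \<and> (triple_shape A B c (X x1) (Y y1) \<or> triple_shape B A c (Y y1) (X x1))"
  proof (cases "B < A")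
    case True
    show ?thesis
      using three_solutions_on_line[OF B2 gap(1)[OF True] X_pos Y_pos c n(1) nm sol]
      by (auto simp: triple_shape_def)
  next
    case False
    hence "A < B" using AB by simp
    from three_solutions_on_line[OF A2 gap(2)[OF this] Y_pos X_pos c n(1) nm
        sol[THEN is_solution_commute[THEN iffD1]]]
    show ?thesis by (auto simp: triple_shape_def)
  qed
  \<comment> \<open>The ratios found are 2, 3 or 6, none of them a proper power, so the primitive
    vector is (1, 1).\<close>
  have "\<alpha> = 1 \<and> b = B"
    by (rule power_eq_2_3_6) (use b key in \<open>auto simp: B_def triple_shape_def\<close>)
  moreover have "\<beta> = 1 \<and> a = A"
    by (rule power_eq_2_3_6) (use a key in \<open>auto simp: A_def triple_shape_def\<close>)
  ultimately show ?thesis using key n m by auto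
qed

lemma balanced_inj: "balanced x y \<Longrightarrow> balanced x y' \<Longrightarrow> y = y'"
  using v_Y_eq_iff[of y y'] by (simp add: balanced_def)

definition "balanced_set = {(x, y). balanced x y}"
definition "left_set = {(x, y). left x y}"
definition "right_set = {(x, y). right x y}"

lemma inj_on_fst_balanced: "inj_on fst balanced_set"
  by (auto simp: inj_on_def balanced_set_def dest: balanced_inj)

text \<open>With four, \<open>three_balanced\<close> would place both the third and the fourth at
  \<open>x1 + 2\<close>.\<close>

lemma card_balanced: "finite balanced_set \<and> card balanced_set \<le> 3"
proof -
  have "finite (fst ` balanced_set) \<and> card (fst ` balanced_set) \<le> 3"
  proof (rule ccontr)
    assume "\<not> ?thesis"
    then obtain x1 x2 x3 x4 where "x1 \<in> fst ` balanced_set" "x2 \<in> fst ` balanced_set"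
      "x3 \<in> fst ` balanced_set" "x4 \<in> fst ` balanced_set" and less: "x1 < x2" "x2 < x3" "x3 < x4"
      by (rule ex_increasing_4)
    then obtain y1 y2 y3 y4 where "balanced x1 y1" "balanced x2 y2" "balanced x3 y3" "balanced x4 y4"
      by (auto simp: balanced_set_def)
    with three_balanced[of x1 y1 x2 y2 x3 y3] three_balanced[of x1 y1 x2 y2 x4 y4] less
    show False by auto
  qed
  thus ?thesis by (simp add: finite_image_iff card_image inj_on_fst_balanced)
qed

lemma left_x_eq: "left x y \<Longrightarrow> left x' y' \<Longrightarrow> x = x'"
  using v_X_eq_iff[of x x'] by (simp add: left_def)

text \<open>With three, the two larger values of \<open>Y\<close> would both be
  \<open>c + X\<close>.\<close>

lemma card_left: "finite left_set \<and> card left_set \<le> 2"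
proof -
  have inj: "inj_on snd left_set"
    by (auto simp: inj_on_def left_set_def dest: left_x_eq)
  have "finite (snd ` left_set) \<and> card (snd ` left_set) \<le> 2"
  proof (rule ccontr)
    assume "\<not> ?thesis"
    then obtain y1 y2 y3 where "y1 \<in> snd ` left_set" "y2 \<in> snd ` left_set"
      "y3 \<in> snd ` left_set" and less: "y1 < y2" "y2 < y3"
      by (rule ex_increasing_3)
    then obtain x1 x2 x3 where L: "left x1 y1" "left x2 y2" "left x3 y3"
      by (auto simp: left_set_def)
    have "Y y2 = Y y3"
      using left_pair(4)[OF L(1,2)] left_pair(4)[OF L(1,3)] less by simp
    thus False using less by (simp add: Y_eq_iff)
  qed
  thus ?thesis by (simp add: finite_image_iff card_image inj)
qed

lemma swap_simps:
  "common_prime.balanced b a c s r p y x \<longleftrightarrow> balanced x y"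
  "common_prime.left b a c s r p y x \<longleftrightarrow> right x y"
  "common_prime.right b a c s r p y x \<longleftrightarrow> left x y"
proof -
  interpret sw: common_prime b a c s r p by (rule swap)
  show "sw.balanced y x \<longleftrightarrow> balanced x y" "sw.left y x \<longleftrightarrow> right x y" "sw.right y x \<longleftrightarrow> left x y"
    by (auto simp: sw.balanced_def sw.left_def sw.right_def balanced_def left_def right_def
        is_solution_commute[of c "X x"])
qed

lemma swap_sets:
  "common_prime.balanced_set b a c s r p = prod.swap ` balanced_set"
  "common_prime.left_set b a c s r p = prod.swap ` right_set"
  "common_prime.right_set b a c s r p = prod.swap ` left_set"
proof -
  interpret sw: common_prime b a c s r p by (rule swap)
  show "sw.balanced_set = prod.swap ` balanced_set" "sw.left_set = prod.swap ` right_set"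
    "sw.right_set = prod.swap ` left_set"
    by (auto simp: sw.balanced_set_def sw.left_set_def sw.right_set_def balanced_set_def
        left_set_def right_set_def swap_simps image_iff)
qed

lemma card_right: "finite right_set \<and> card right_set \<le> 2"
  using common_prime.card_left[OF swap] unfolding swap_sets
  by (simp add: finite_image_iff card_image)

lemma solution_pairs_iff: "(x, y) \<in> solution_pairs a b c r s \<longleftrightarrow> is_solution c (X x) (Y y)"
proof -
  have split: "(\<exists>u w. u \<in> {0, 1} \<and> w \<in> {0, 1} \<and> Q u w) \<longleftrightarrow> Q 0 0 \<or> Q 0 1 \<or> Q 1 0 \<or> Q 1 1"
    for Q :: "nat \<Rightarrow> nat \<Rightarrow> bool"
    by blast
  have "(x, y) \<in> solution_pairs a b c r s \<longleftrightarrow>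
      X x + Y y = c \<or> X x - Y y = c \<or> Y y - X x = c \<or> - X x - Y y = c"
    unfolding mem_solution_pairs_iff solutions_def mem_Collect_eq case_prod_conv split
    by (simp add: geom_def)
  thus ?thesis using c X_pos[of x] Y_pos[of y] unfolding is_solution_def by linarith
qed

lemma solution_pairs_eq: "solution_pairs a b c r s = balanced_set \<union> left_set \<union> right_set"
proof -
  have "is_solution c (X x) (Y y) \<longleftrightarrow> balanced x y \<or> left x y \<or> right x y" for x y
    using solution_cases[of x y] unfolding balanced_def left_def right_def by blast
  thus ?thesis
    by (auto simp: solution_pairs_iff balanced_set_def left_set_def right_set_def)
qed

lemma finite_solution_pairs: "finite (solution_pairs a b c r s)"
  using card_balanced card_left card_right by (simp add: solution_pairs_eq)

lemma card_solution_pairs_le: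
  "card (solution_pairs a b c r s) \<le> card balanced_set + card left_set + card right_set"
  unfolding solution_pairs_eq
  using card_Un_le[of "balanced_set \<union> left_set" right_set] card_Un_le[of balanced_set left_set]
  by linarith

lemma card_solutions:
  "finite (solutions a b c r s)" "card (solutions a b c r s) = card (solution_pairs a b c r s)"
proof -
  have inj: "inj_on (\<lambda>(x, y, u, v). (x, y)) (solutions a b c r s)"
    using solution_pair_determines_signs[OF a b c r s] by (auto simp: inj_on_def)
  show "card (solutions a b c r s) = card (solution_pairs a b c r s)"
    unfolding solution_pairs_def using inj by (simp add: card_image)
  show "finite (solutions a b c r s)"
    using finite_solution_pairs inj unfolding solution_pairs_def by (rule finite_imageD)
qed

end

section \<open>Families\<close>

lemma solution_pairs_swap: "solution_pairs b a c s r = prod.swap ` solution_pairs a b c r s"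
proof -
  have "(y, x, v, u) \<in> solutions b a c s r \<longleftrightarrow> (x, y, u, v) \<in> solutions a b c r s" for x y u v
    unfolding solutions_def mem_Collect_eq case_prod_conv by (metis add.commute)
  hence "(y, x) \<in> solution_pairs b a c s r \<longleftrightarrow> (x, y) \<in> solution_pairs a b c r s" for x y
    unfolding mem_solution_pairs_iff by blast
  thus ?thesis by (force simp: image_iff)
qed

lemma is_solution_set_associate:
  assumes "is_solution_set F"
  shows "is_solution_set (associate F)"
proof -
  obtain a b c r s P where F: "F = (a, b, c, r, s, P)" by (cases F)
  thus ?thesis using assms solution_pairs_swap[of b a c s r] by (auto simp: card_image)
qed

lemma associate_associate: "associate (associate F) = F"
  by (cases F) (simp add: image_image)

lemma same_family_associate:
  assumes "same_family G F"
  shows "same_family (associate G) (associate F)"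
proof -
  obtain a b c r s P where G: "G = (a, b, c, r, s, P)" by (cases G)
  obtain A B C R S Q where F: "F = (A, B, C, R, S, Q)" by (cases F)
  have "is_solution_set G" "is_solution_set F" using assms by (auto simp: G F)
  hence "is_solution_set (associate G)" "is_solution_set (associate F)"
    by (auto intro: is_solution_set_associate)
  moreover obtain k :: rat where "k > 0" "k * of_int c = of_int C"
    "\<forall>(x, y) \<in> P. \<exists>(X, Y) \<in> Q. k * of_int r * of_int a ^ x = of_int R * of_int A ^ X \<and>
       k * of_int s * of_int b ^ y = of_int S * of_int B ^ Y"
    using assms unfolding G F by auto
  moreover from this have "\<forall>(y, x) \<in> prod.swap ` P. \<exists>(Y, X) \<in> prod.swap ` Q.
      k * of_int s * of_int b ^ y = of_int S * of_int B ^ Y \<and>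
      k * of_int r * of_int a ^ x = of_int R * of_int A ^ X"
    by fastforce
  moreover have "card (prod.swap ` P) = card (prod.swap ` Q)"
    "powers_of_one_integer a A" "powers_of_one_integer b B"
    using assms unfolding G F by (auto simp: card_image)
  ultimately show ?thesis
    unfolding G F associate.simps same_family.simps by blast
qed

definition exceptional :: "int \<Rightarrow> int \<Rightarrow> int \<Rightarrow> int \<Rightarrow> int \<Rightarrow> bool" where
  "exceptional a b c r s \<longleftrightarrow>
     (\<exists>F \<in> exceptional_forms \<union> associate ` exceptional_forms.
        same_family (a, b, c, r, s, solution_pairs a b c r s) F)"

text \<open>The list of exceptional forms is closed under associates, since \<open>associate\<close>
  is an involution.\<close>

lemma exceptional_swap:
  assumes "exceptional b a c s r"
  shows "exceptional a b c r s"
proof -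
  obtain F where F: "F \<in> exceptional_forms \<union> associate ` exceptional_forms"
    "same_family (b, a, c, s, r, solution_pairs b a c s r) F"
    using assms unfolding exceptional_def by blast
  have "same_family (a, b, c, r, s, solution_pairs a b c r s) (associate F)"
    using same_family_associate[OF F(2)] by (simp add: solution_pairs_swap[of a b])
  moreover have "associate F \<in> exceptional_forms \<union> associate ` exceptional_forms"
    using F(1) associate_associate by auto
  ultimately show ?thesis unfolding exceptional_def by blast
qed

text \<open>The scaling factor is \<open>k = R / geom r a x0\<close>, matching each pair with its
  unshifted one; \<open>ratio\<close> states \<open>k * c = C\<close> and
  \<open>k * geom s b y0 = S\<close> without denominators.\<close>

lemma same_family_shift:
  assumes pos: "1 < a" "1 < b" "0 < c" "0 < r" "0 < s"
    and Q: "is_solution_set (a, b, C, R, S, Q)"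
    and P: "solution_pairs a b c r s = (\<lambda>(u, w). (x0 + u, y0 + w)) ` Q"
    and ratio: "R * c = C * geom r a x0" "R * geom s b y0 = S * geom r a x0"
  shows "same_family (a, b, c, r, s, solution_pairs a b c r s) (a, b, C, R, S, Q)"
proof -
  define k :: rat where "k = of_int R / of_int (geom r a x0)"
  have X: "0 < geom r a x0" using geom_pos pos by simp
  have R: "0 < R" using Q by simp
  have inj: "inj_on (\<lambda>(u, w). (x0 + u, y0 + w)) Q" by (auto simp: inj_on_def)
  have kX: "k * of_int (geom r a x0) = of_int R" using X by (simp add: k_def)
  have kc: "k * of_int c = of_int C"
  proof -
    have "of_int R * of_int c = (of_int C * of_int (geom r a x0) :: rat)"
      using ratio(1) by (metis of_int_mult)
    thus ?thesis using X by (simp add: k_def)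
  qed
  have kY: "k * of_int (geom s b y0) = of_int S"
  proof -
    have "of_int R * of_int (geom s b y0) = (of_int S * of_int (geom r a x0) :: rat)"
      using ratio(2) by (metis of_int_mult)
    thus ?thesis using X by (simp add: k_def)
  qed
  have kx: "k * of_int r * of_int a ^ (x0 + u) = of_int R * of_int a ^ u" for u
    unfolding kX[symmetric] by (simp add: geom_def power_add)
  have ky: "k * of_int s * of_int b ^ (y0 + w) = of_int S * of_int b ^ w" for w
    unfolding kY[symmetric] by (simp add: geom_def power_add)
  have pairs: "\<forall>(x, y) \<in> solution_pairs a b c r s. \<exists>(u, w) \<in> Q.
      k * of_int r * of_int a ^ x = of_int R * of_int a ^ u \<and>
      k * of_int s * of_int b ^ y = of_int S * of_int b ^ w"
  proof clarify
    fix x y assume "(x, y) \<in> solution_pairs a b c r s"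
    then obtain u w where "(u, w) \<in> Q" "x = x0 + u" "y = y0 + w" by (auto simp: P)
    thus "\<exists>(u, w) \<in> Q. k * of_int r * of_int a ^ x = of_int R * of_int a ^ u \<and>
        k * of_int s * of_int b ^ y = of_int S * of_int b ^ w"
      by (intro bexI[of _ "(u, w)"]) (simp_all only: kx ky case_prod_conv simp_thms)
  qed
  have "0 < k" using X R by (simp add: k_def)
  moreover have pow: "powers_of_one_integer z z" for z
    unfolding powers_of_one_integer_def
    by (rule exI[of _ z], rule exI[of _ 1], rule exI[of _ 1]) simp
  moreover have card: "card (solution_pairs a b c r s) = card Q" and "finite (solution_pairs a b c r s)"
    using inj Q by (simp_all add: P card_image)
  moreover from this have "is_solution_set (a, b, c, r, s, solution_pairs a b c r s)"
    using Q pos by simp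
  ultimately show ?thesis unfolding same_family.simps
    by (intro conjI exI[of _ k] pow Q kc pairs)
qed

lemma is_solution_set_exceptional:
  assumes "F \<in> exceptional_forms \<union> associate ` exceptional_forms"
  shows "is_solution_set F"
proof -
  have "is_solution_set G" if "G \<in> exceptional_forms" for G
    using exceptional_forms_basic_form[OF that] by (cases G) simp
  thus ?thesis using assms is_solution_set_associate by blast
qed

section \<open>Four solutions force an exceptional family\<close>

context common_prime
begin

text \<open>When \<open>v a = v b = 1\<close>, valuations count exponents, so \<open>v c\<close>
  fixes \<open>x\<close> for left solutions and \<open>y\<close> for right ones.\<close>

lemma left_right_offset:
  assumes bal: "balanced x1 y1" and "v a = 1" "v b = 1" "v c = v (X x1) + k"
  shows "left x y \<Longrightarrow> x = x1 + k \<and> y1 + k < y" "right x y \<Longrightarrow> y = y1 + k \<and> x1 + k < x"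
  using assms by (auto simp: balanced_def left_def right_def v_X v_Y)

text \<open>The triple exhausts the balanced solutions. For \<open>b = 2\<close> a fourth can only
  be one specific left solution; for \<open>b = 3\<close> size leaves none, contradicting
  \<open>card\<close>.\<close>

lemma exceptional_if_triple:
  assumes bal: "balanced x1 y1" "balanced (x1 + 1) (y1 + 1)" "balanced (x1 + 2) (y1 + 2)"
    and shape: "triple_shape a b c (X x1) (Y y1)"
    and card: "4 \<le> card (solution_pairs a b c r s)"
  shows "exceptional a b c r s"
proof -
  have a6: "a = 6" and b23: "b = 2 \<or> b = 3" using shape by (auto simp: triple_shape_def)
  have "{(x1, y1), (x1 + 1, y1 + 1), (x1 + 2, y1 + 2)} = balanced_set"
    using bal card_balanced by (intro card_seteq) (auto simp: balanced_set_def)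
  note bset = this[symmetric]
  have Xpos: "0 < X x1" by (rule X_pos)
  have pe: "prime_elem p" using p by auto
  have v6: "v 6 = v 2 + v 3"
    using prime_elem_multiplicity_mult_distrib[OF pe, of 2 3] by simp
  show ?thesis
  proof (cases "b = 2")
    case b2: True
    have shape': "c = 8 * X x1" "Y y1 = 7 * X x1" using shape b2 by (auto simp: triple_shape_def)
    have p2: "p = 2" using primes_dvd_imp_eq[of p 2] p b2 by simp
    have v2: "v 2 = 1" "v 3 = 0" using p2 by (simp_all add: not_dvd_imp_multiplicity_0)
    have "v (2 ^ 3 * X x1) = v (2 ^ 3) + v (X x1)"
      using Xpos by (intro prime_elem_multiplicity_mult_distrib[OF pe]) auto
    also have "v (2 ^ 3) = 3" using prime_elem_multiplicity_power_distrib[OF pe, of 2 3] v2 by simp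
    finally have vc: "v c = v (X x1) + 3" using shape' by simp
    have va: "v a = 1" "v b = 1" using v6 v2 a6 b2 by simp_all
    note off = left_right_offset[OF bal(1) va vc]
    have "right_set = {}"
    proof -
      have False if R: "right x y" for x y
      proof -
        have xy: "y = y1 + 3" "x1 + 4 \<le> x" using off(2)[OF R] by auto
        have "Y y = 8 * Y y1" by (simp add: geom_add b2 xy(1))
        moreover have "X (x1 + 4) \<le> X x" using xy(2) by (rule X_mono)
        moreover have "X (x1 + 4) = 1296 * X x1" by (simp add: geom_add a6)
        moreover have "X x \<le> c + Y y"
          using R c Y_pos[of y] by (auto simp: right_def is_solution_def)
        ultimately show False using shape' Xpos by linarith
      qed
      thus ?thesis by (auto simp: right_set_def)
    qed
    moreover have "left_set \<subseteq> {(x1 + 3, y1 + 5)}"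
    proof -
      have "x = x1 + 3 \<and> y = y1 + 5" if L: "left x y" for x y
      proof -
        have xy: "x = x1 + 3" "y1 \<le> y" using off(1)[OF L] by auto
        have X: "X x = 216 * X x1" by (simp add: geom_def power_add a6 xy(1))
        have Y: "Y y = X x1 * (7 * 2 ^ (y - y1))"
          using geom_eq_mult[OF xy(2), of s b] shape' b2 by simp
        have "is_solution c (X x) (Y y)" using L by (simp add: left_def)
        \<comment> \<open>These are 216 - 8 and 216 + 8; 7 does not divide 208, and 224 is 7 times
          \<open>2 ^ 5\<close>.\<close>
        hence "Y y = X x1 * 208 \<or> Y y = X x1 * 224"
          using X shape'(1) Xpos Y_pos[of y] unfolding is_solution_def by linarith
        hence "7 * 2 ^ (y - y1) = (208::int) \<or> 7 * 2 ^ (y - y1) = (224::int)"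
          unfolding Y using Xpos by simp
        moreover have "7 * 2 ^ (y - y1) \<noteq> (208::int)" by presburger
        ultimately have "(2::int) ^ (y - y1) = 2 ^ 5" by simp
        hence "y - y1 = 5" by (simp only: power_inject_exp)
        thus ?thesis using xy by simp
      qed
      thus ?thesis by (auto simp: left_set_def)
    qed
    ultimately have "solution_pairs a b c r s \<subseteq>
        {(x1, y1), (x1 + 1, y1 + 1), (x1 + 2, y1 + 2), (x1 + 3, y1 + 5)}"
      unfolding solution_pairs_eq bset by blast
    hence "solution_pairs a b c r s = {(x1, y1), (x1 + 1, y1 + 1), (x1 + 2, y1 + 2), (x1 + 3, y1 + 5)}"
      using card by (intro card_seteq) auto
    hence P: "solution_pairs a b c r s =
        (\<lambda>(u, w). (x1 + u, y1 + w)) ` {(0, 0), (1, 1), (2, 2), (3, 5)}" by simp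
    have F: "(a, b, 8, 1, 7, {(0, 0), (1, 1), (2, 2), (3, 5)}) \<in> exceptional_forms"
      by (simp add: exceptional_forms_def a6 b2)
    have "same_family (a, b, c, r, s, solution_pairs a b c r s)
        (a, b, 8, 1, 7, {(0, 0), (1, 1), (2, 2), (3, 5)})"
      by (rule same_family_shift[OF a b c r s is_solution_set_exceptional P])
        (use F shape' in auto)
    thus ?thesis using F unfolding exceptional_def by blast
  next
    case False
    hence b3: "b = 3" using b23 by simp
    have shape': "2 * c = 9 * X x1" "2 * Y y1 = 7 * X x1"
      using shape b3 by (auto simp: triple_shape_def)
    have p3: "p = 3" using primes_dvd_imp_eq[of p 3] p b3 by simp
    have v2: "v 2 = 0" "v 3 = 1" using p3 by (simp_all add: not_dvd_imp_multiplicity_0)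
    have "v (2 * c) = v 2 + v c"
      using c by (intro prime_elem_multiplicity_mult_distrib[OF pe]) auto
    moreover have "v (3 ^ 2 * X x1) = v (3 ^ 2) + v (X x1)"
      using Xpos by (intro prime_elem_multiplicity_mult_distrib[OF pe]) auto
    moreover have "v (3 ^ 2) = 2"
      using prime_elem_multiplicity_power_distrib[OF pe, of 3 2] v2 by simp
    ultimately have vc: "v c = v (X x1) + 2" using shape' v2 by simp
    have va: "v a = 1" "v b = 1" using v6 v2 a6 b3 by simp_all
    note off = left_right_offset[OF bal(1) va vc]
    have "right_set = {}"
    proof -
      have False if R: "right x y" for x y
      proof -
        have xy: "y = y1 + 2" "x1 + 3 \<le> x" using off(2)[OF R] by auto
        have "Y y = 9 * Y y1" by (simp add: geom_def b3 xy(1))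
        moreover have "X (x1 + 3) \<le> X x" using xy(2) by (rule X_mono)
        moreover have "X (x1 + 3) = 216 * X x1" by (simp add: geom_add a6)
        moreover have "X x \<le> c + Y y"
          using R c Y_pos[of y] by (auto simp: right_def is_solution_def)
        ultimately show False using shape' Xpos by linarith
      qed
      thus ?thesis by (auto simp: right_set_def)
    qed
    moreover have "left_set = {}"
    proof -
      have False if L: "left x y" for x y
      proof -
        have xy: "x = x1 + 2" "y1 + 3 \<le> y" using off(1)[OF L] by auto
        have "X x = 36 * X x1" by (simp add: geom_def power_add a6 xy(1))
        moreover have "Y (y1 + 3) \<le> Y y" using xy(2) by (rule Y_mono)
        moreover have "Y (y1 + 3) = 27 * Y y1" by (simp add: geom_add b3)
        moreover have "Y y \<le> c + X x"
          using L c X_pos[of x] by (auto simp: left_def is_solution_def)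
        ultimately show False using shape' Xpos by linarith
      qed
      thus ?thesis by (auto simp: left_set_def)
    qed
    ultimately show ?thesis using card card_solution_pairs_le card_balanced by simp
  qed
qed

lemma balanced_setE:
  assumes "card balanced_set = 2"
  obtains x1 y1 x2 y2 where "x1 < x2" "balanced x1 y1" "balanced x2 y2"
    "balanced_set = {(x1, y1), (x2, y2)}"
proof -
  obtain q1 q2 where q: "balanced_set = {q1, q2}" "q1 \<noteq> q2" using assms by (auto simp: card_2_iff)
  hence "fst q1 \<noteq> fst q2" using inj_on_fst_balanced by (auto simp: inj_on_def)
  moreover have "balanced (fst q1) (snd q1)" "balanced (fst q2) (snd q2)"
    using q by (auto simp: balanced_set_def set_eq_iff)
  ultimately show ?thesis
    using that[of "fst q1" "fst q2" "snd q1" "snd q2"] that[of "fst q2" "fst q1" "snd q2" "snd q1"] q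
    by (cases "fst q1" "fst q2" rule: linorder_cases) (auto simp: insert_commute)
qed

lemma left_setE:
  assumes "card left_set = 2"
  obtains x y' y where "y' < y" "left x y'" "left x y" "left_set = {(x, y'), (x, y)}"
proof -
  obtain q1 q2 where q: "left_set = {q1, q2}" "q1 \<noteq> q2" using assms by (auto simp: card_2_iff)
  obtain x1 y1 x2 y2 where xy: "q1 = (x1, y1)" "q2 = (x2, y2)" by (cases q1, cases q2)
  have L: "left x1 y1" "left x2 y2"
    using q xy by (auto simp: left_set_def set_eq_iff)
  have x: "x1 = x2" by (rule left_x_eq[OF L])
  show ?thesis
  proof (cases "y1 < y2")
    case True
    thus ?thesis using that[of y1 y2 x1] q xy x L by simp
  next
    case False
    hence "y2 < y1" using q xy x by auto
    thus ?thesis using that[of y2 y1 x1] q xy x L by (simp add: insert_commute)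
  qed
qed

lemma right_setE:
  assumes "card right_set = 2"
  obtains x' x y where "x' < x" "right x' y" "right x y" "right_set = {(x', y), (x, y)}"
proof -
  interpret sw: common_prime b a c s r p by (rule swap)
  have "card sw.left_set = 2" using assms by (simp add: swap_sets card_image)
  then obtain y x' x where *: "x' < x" "sw.left y x'" "sw.left y x" "sw.left_set = {(y, x'), (y, x)}"
    by (rule sw.left_setE)
  have "right_set = prod.swap ` sw.left_set" by (simp add: swap_sets image_image)
  hence "right_set = {(x', y), (x, y)}" using *(4) by simp
  thus ?thesis using that * by (simp add: swap_simps)
qed

lemma exceptional_if_two_balanced_two_left:
  assumes "card balanced_set = 2" "card left_set = 2"
  shows "exceptional a b c r s"
proof -
  obtain x1 y1 x2 y2 where B: "x1 < x2" "balanced x1 y1" "balanced x2 y2"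
    "balanced_set = {(x1, y1), (x2, y2)}" by (rule balanced_setE[OF assms(1)])
  obtain x y' y where L: "y' < y" "left x y'" "left x y" "left_set = {(x, y'), (x, y)}"
    by (rule left_setE[OF assms(2)])
  have "right_set = {}"
    using not_balanced_balanced_left_right[OF B(2,3,1) L(2)] by (auto simp: right_set_def)
  note val = balanced_balanced_left_left[OF B(2,3,1) L(2,3,1)]
  have P: "solution_pairs a b c r s =
      (\<lambda>(u, w). (x1 + u, y1 + w)) ` {(0, 0), (1, 1), (2, 3), (2, 4)}"
    using \<open>right_set = {}\<close> B(4) L(4) val(5-) by (auto simp: solution_pairs_eq)
  \<comment> \<open>Here \<open>X x1 = 3 * Y y1\<close>, so the coefficients appear as 3, 1 and the
    form obtained is the associate.\<close>
  have "(2, 2, 4, 1, 3, {(0, 0), (1, 1), (3, 2), (4, 2)}) \<in> exceptional_forms"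
    by (simp add: exceptional_forms_def)
  hence "associate (2, 2, 4, 1, 3, {(0, 0), (1, 1), (3, 2), (4, 2)}) \<in> associate ` exceptional_forms"
    by (rule imageI)
  hence F: "(a, b, 4, 3, 1, {(0, 0), (1, 1), (2, 3), (2, 4)}) \<in>
      exceptional_forms \<union> associate ` exceptional_forms"
    using val(1,2) by simp
  have "same_family (a, b, c, r, s, solution_pairs a b c r s)
      (a, b, 4, 3, 1, {(0, 0), (1, 1), (2, 3), (2, 4)})"
    by (rule same_family_shift[OF a b c r s is_solution_set_exceptional[OF F] P])
      (use val in auto)
  thus ?thesis using F unfolding exceptional_def by blast
qed

lemma exceptional_if_two_left_two_right:
  assumes "card left_set = 2" "card right_set = 2"
  shows "exceptional a b c r s"
proof -
  obtain x0 y' y where L: "y' < y" "left x0 y'" "left x0 y" "left_set = {(x0, y'), (x0, y)}"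
    by (rule left_setE[OF assms(1)])
  obtain x' x y0 where R: "x' < x" "right x' y0" "right x y0" "right_set = {(x', y0), (x, y0)}"
    by (rule right_setE[OF assms(2)])
  interpret sw: common_prime b a c s r p by (rule swap)
  have "balanced_set = {}"
    using not_left_left_right_balanced[OF L(2,3,1) R(2)] by (auto simp: balanced_set_def)
  \<comment> \<open>\<open>left_left_right\<close> and its mirror image each allow two ratios of
    \<open>X x0\<close> to \<open>Y y0\<close>; only equality satisfies both.\<close>
  have b2: "b = 2" and a2: "a = 2" and X: "X x0 = Y y0" "c = 3 * Y y0"
  proof -
    have sw: "sw.left y0 x'" "sw.left y0 x" "sw.right y' x0"
      using L R by (simp_all only: swap_simps)
    show "b = 2" "a = 2" "X x0 = Y y0" "c = 3 * Y y0"
      using left_left_right[OF L(2,3,1) R(2)] sw.left_left_right[OF sw(1,2) R(1) sw(3)]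
        Y_pos[of y0] by linarith+
  qed
  have next_Y: "Y (y0 + 1) = 2 * Y y0" "Y (y0 + 2) = 4 * Y y0"
    and next_X: "X (x0 + 1) = 2 * X x0" "X (x0 + 2) = 4 * X x0"
    by (simp_all only: geom_add a2 b2) simp_all
  have "Y y = c + X x0" by (rule left_pair(4)[OF L(2,3,1)])
  hence "Y y = Y (y0 + 2)" using X next_Y by simp
  hence y: "y = y0 + 2" by (simp only: Y_eq_iff)
  have "Y y' \<noteq> Y y" using L(1) by (simp add: Y_eq_iff)
  moreover have "is_solution c (X x0) (Y y')" using L(2) by (simp add: left_def)
  ultimately have "Y y' = Y (y0 + 1)"
    using X next_Y Y_pos[of y'] Y_pos[of y0] unfolding is_solution_def y
    by (elim disjE) linarith+
  hence y': "y' = y0 + 1" by (simp only: Y_eq_iff)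
  have "X x = c + Y y0" using sw.left_pair(4)[of y0 x' y0 x] R by (simp add: swap_simps)
  hence "X x = X (x0 + 2)" using X next_X by simp
  hence x: "x = x0 + 2" by (simp only: X_eq_iff)
  have "X x' \<noteq> X x" using R(1) by (simp add: X_eq_iff)
  moreover have "is_solution c (X x') (Y y0)" using R(2) by (simp add: right_def)
  ultimately have "X x' = X (x0 + 1)"
    using X next_X X_pos[of x'] X_pos[of x0] unfolding is_solution_def x
    by (elim disjE) linarith+
  hence x': "x' = x0 + 1" by (simp only: X_eq_iff)
  have P: "solution_pairs a b c r s =
      (\<lambda>(u, w). (x0 + u, y0 + w)) ` {(0, 1), (0, 2), (1, 0), (2, 0)}"
    using \<open>balanced_set = {}\<close> L(4) R(4) y y' x x' by (auto simp: solution_pairs_eq)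
  have F: "(a, b, 3, 1, 1, {(0, 1), (0, 2), (1, 0), (2, 0)}) \<in> exceptional_forms"
    by (simp add: exceptional_forms_def a2 b2)
  have "same_family (a, b, c, r, s, solution_pairs a b c r s)
      (a, b, 3, 1, 1, {(0, 1), (0, 2), (1, 0), (2, 0)})"
    by (rule same_family_shift[OF a b c r s is_solution_set_exceptional P])
      (use F X in auto)
  thus ?thesis using F unfolding exceptional_def by blast
qed

text \<open>Split by the number of balanced solutions. Three, two with a pair of one other type, or
  none with two pairs are exceptional; the remaining distributions contradict the exclusion
  lemmas.\<close>

lemma exceptional_if_card_ge_4:
  assumes card: "4 \<le> card (solution_pairs a b c r s)"
  shows "exceptional a b c r s"
proof -
  interpret sw: common_prime b a c s r p by (rule swap)
  have sw_card: "card sw.balanced_set = card balanced_set" "card sw.left_set = card right_set"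
    "card sw.right_set = card left_set"
    by (simp_all add: swap_sets card_image)
  have sum: "4 \<le> card balanced_set + card left_set + card right_set"
    using card card_solution_pairs_le by linarith
  have le: "card balanced_set \<le> 3" "card left_set \<le> 2" "card right_set \<le> 2"
    using card_balanced card_left card_right by auto
  have exL: "\<exists>x y. left x y" if "card left_set \<noteq> 0"
    using that by (auto simp: left_set_def card_eq_0_iff)
  have exR: "\<exists>x y. right x y" if "card right_set \<noteq> 0"
    using that by (auto simp: right_set_def card_eq_0_iff)
  have exB: "\<exists>x y. balanced x y" if "card balanced_set \<noteq> 0"
    using that by (auto simp: balanced_set_def card_eq_0_iff)
  consider "card balanced_set = 3" | "card balanced_set = 2" | "card balanced_set = 1"
    | "card balanced_set = 0" using le by linarith
  thus ?thesis
  proof cases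
    case 1
    hence "\<not> (finite (fst ` balanced_set) \<and> card (fst ` balanced_set) \<le> 2)"
      by (simp add: card_image inj_on_fst_balanced)
    then obtain x1 x2 x3 where "x1 \<in> fst ` balanced_set" "x2 \<in> fst ` balanced_set"
      "x3 \<in> fst ` balanced_set" and less: "x1 < x2" "x2 < x3"
      by (rule ex_increasing_3)
    then obtain y1 y2 y3 where bal: "balanced x1 y1" "balanced x2 y2" "balanced x3 y3"
      by (auto simp: balanced_set_def)
    note three = three_balanced[OF bal less]
    hence bal': "balanced x1 y1" "balanced (x1 + 1) (y1 + 1)" "balanced (x1 + 2) (y1 + 2)"
      using bal by auto
    have "exceptional b a c s r" if "triple_shape b a c (Y y1) (X x1)"
      using bal' card that
      by (intro sw.exceptional_if_triple[of y1 x1])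
        (simp_all only: swap_simps solution_pairs_swap[of b a c s r] card_image inj_swap)
    thus ?thesis using three exceptional_if_triple[OF bal' _ card] exceptional_swap by blast
  next
    case 2
    show ?thesis
    proof (cases "card left_set = 2 \<or> card right_set = 2")
      case True
      thus ?thesis
        using 2 exceptional_if_two_balanced_two_left sw.exceptional_if_two_balanced_two_left
          exceptional_swap sw_card by metis
    next
      case False
      hence "card left_set \<noteq> 0" "card right_set \<noteq> 0" using sum le 2 by auto
      with exL exR obtain x y x' y' where "left x y" "right x' y'" by blast
      thus ?thesis
        using not_balanced_balanced_left_right balanced_setE[OF 2] by metis
    qed
  next
    case 3
    then obtain x1 y1 where bal: "balanced x1 y1" using exB by auto
    have "card left_set = 2 \<and> card right_set \<noteq> 0 \<or> card right_set = 2 \<and> card left_set \<noteq> 0"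
      using sum le 3 by auto
    thus ?thesis
    proof
      assume *: "card left_set = 2 \<and> card right_set \<noteq> 0"
      then obtain x y where "right x y" using exR by blast
      thus ?thesis
        using not_left_left_right_balanced bal left_setE * by metis
    next
      assume *: "card right_set = 2 \<and> card left_set \<noteq> 0"
      then obtain x y where L: "left x y" using exL by blast
      obtain x' x'' y0 where "x' < x''" "right x' y0" "right x'' y0" using right_setE * by metis
      thus ?thesis
        using sw.not_left_left_right_balanced[of y0 x' y0 x'' y x y1 x1] bal L
        by (simp add: swap_simps)
    qed
  next
    case 4
    hence "card left_set = 2" "card right_set = 2" using sum le by auto
    thus ?thesis by (rule exceptional_if_two_left_two_right)
  qed
qed

end

section \<open>Infinitely many basic forms with three solutions\<close>

text \<open>
  With \<open>r = 1\<close> and \<open>b = 2\<close> the pairs \<open>(0, 0)\<close> and \<open>(1, 1)\<close> force \<open>s = a + 1\<close> and \<open>c = a + 2\<close>;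
  then \<open>a\<^sup>2 - c = (a + 1) (a - 2)\<close>, so \<open>a - 2 = 2\<^sup>t\<close> yields the third pair \<open>(2, t)\<close>.
\<close>

lemma basic_form_three_solutions:
  assumes "2 \<le> t"
  shows "basic_form (2 ^ t + 2, 2, 2 ^ t + 4, 1, 2 ^ t + 3, {(0, 0), (1, 1), (2, t)})"
proof -
  define q :: int where "q = 2 ^ t"
  have q: "4 \<le> q" "4 dvd q"
    using assms power_increasing[of 2 t "2::int"] le_imp_power_dvd[of 2 t "2::int"]
    by (auto simp: q_def)
  \<comment> \<open>As \<open>t \<ge> 2\<close>, the base is 2 modulo 4.\<close>
  have "\<not> perfect_power (q + 2)"
  proof (rule not_perfect_power_if_dvd_once[of 2])
    show "(2::int) dvd q + 2" "\<not> 2\<^sup>2 dvd q + 2" using q(2) by (simp_all, presburger+)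
  qed simp
  moreover have "\<not> perfect_power (2::int)" by (rule not_perfect_power_if_dvd_once[of 2]) simp_all
  moreover have "{(0, 0), (1, 1), (2, t)} \<subseteq> solution_pairs (q + 2) 2 (q + 4) 1 (q + 3)"
  proof -
    have "(0, 0, 0, 0) \<in> solutions (q + 2) 2 (q + 4) 1 (q + 3)"
      "(1, 1, 1, 0) \<in> solutions (q + 2) 2 (q + 4) 1 (q + 3)"
      "(2, t, 0, 1) \<in> solutions (q + 2) 2 (q + 4) 1 (q + 3)"
      by (simp_all add: solutions_def power2_eq_square algebra_simps flip: q_def)
    thus ?thesis by (auto simp: mem_solution_pairs_iff)
  qed
  moreover have "gcd (q + 3) (q + 2) = 1"
    using coprime_add_one_left[of "q + 2"] by (simp add: add.commute add.left_commute)
  moreover have "card {(0::nat, 0::nat), (1, 1), (2, t)} = 3" by simp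
  ultimately show ?thesis using q(1) unfolding q_def[symmetric] by simp
qed

lemma infinite_basic_forms_three_solutions:
  "infinite {(a, b, c, r, s, P). basic_form (a, b, c, r, s, P) \<and> gcd a b > 1 \<and> card P = 3}"
proof -
  define F :: "nat \<Rightarrow> sol_set" where
    "F t = (2 ^ t + 2, 2, 2 ^ t + 4, 1, 2 ^ t + 3, {(0, 0), (1, 1), (2, t)})" for t
  have "inj F" by (auto simp: inj_def F_def)
  hence "infinite (F ` {2..})" by (simp add: finite_image_iff inj_on_subset infinite_Ici)
  moreover have "F ` {2..} \<subseteq> {(a, b, c, r, s, P). basic_form (a, b, c, r, s, P) \<and> gcd a b > 1 \<and> card P = 3}"
  proof -
    have "gcd (2 ^ t + 2) 2 = (2::int)" if "2 \<le> t" for t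
      using that by (simp add: gcd_proj2_iff)
    thus ?thesis using basic_form_three_solutions
      by (auto simp: F_def simp del: basic_form.simps)
  qed
  ultimately show ?thesis using finite_subset by blast
qed

theorem theorem1:
  shows "(\<forall>a b c r s :: int. a > 1 \<longrightarrow> b > 1 \<longrightarrow> c > 0 \<longrightarrow> r > 0 \<longrightarrow> s > 0 \<longrightarrow> gcd a b > 1 \<longrightarrow>
            (finite (solutions a b c r s) \<and> card (solutions a b c r s) \<le> 3) \<or>
            (\<exists>F \<in> exceptional_forms \<union> associate ` exceptional_forms.
               same_family (a, b, c, r, s, solution_pairs a b c r s) F)) \<and>
         infinite {(a, b, c, r, s, P). basic_form (a, b, c, r, s, P) \<and> gcd a b > 1 \<and> card P = 3}"
proof (intro conjI allI impI infinite_basic_forms_three_solutions)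
  fix a b c r s :: int
  assume pos: "a > 1" "b > 1" "c > 0" "r > 0" "s > 0" and "gcd a b > 1"
  then obtain p where "prime p" "p dvd gcd a b" using prime_divisor_exists[of "gcd a b"] by auto
  then interpret common_prime a b c r s p using pos by unfold_locales auto
  show "(finite (solutions a b c r s) \<and> card (solutions a b c r s) \<le> 3) \<or>
      (\<exists>F \<in> exceptional_forms \<union> associate ` exceptional_forms.
         same_family (a, b, c, r, s, solution_pairs a b c r s) F)"
    using exceptional_if_card_ge_4 card_solutions unfolding exceptional_def by fastforce
qed

end
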